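(* Let $n\ge 0$ be an integer, let $m_+\in\mathbb{Z}_{>0}$, and let $m_-$ be any real number with $4m_-\in\mathbb{Z}$ and $2(m_-\pm m_+)\in\mathbb{Z}$ (equivalently $m_-\in\tfrac12\mathbb{Z}$). Put $b=1$ if $m_+\pm m_-\in\mathbb{Z}$ (i.e. $m_-\in\mathbb{Z}$), and $b=2$ otherwise (i.e. $m_-\in\mathbb{Z}+\tfrac12$). Consider the morphism of complex algebraic tori $$\psi_{T,m_-,m_+}:T^n\to T^{\,n+2m_+-2},$$ $$\psi_{T,m_-,m_+}(t_1,\dots,t_n)=\bigl(t_1,\dots,t_n,\,1,\,q^{b},\,q^{b},\,q^{2b},\,q^{2b},\dots,q^{b(m_+-2)},\,q^{b(m_+-2)},\,q^{b(m_+-1)}\bigr),$$ where the last $2m_+-2$ coordinates are $q^{b\lfloor k/2\rfloor}$ for $1\le k\le 2m_+-2$ (there are none if $m_+=1$). Then $\psi_{T,m_-,m_+}$ is a spectral transfer morphism from the normalised affine Hecke algebra with $\mu$-function $\mu^{\,n}_{m_-,m_+}$ to the normalised affine Hecke algebra with $\mu$-function $\mu^{\,n+2m_+-2}_{m_-,m_+-2}$ (both with this same $b$).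
   Context: Throughout $v>1$ is a real parameter, $q=v^2$, and $T^N=(\mathbb{C}^\times)^N$ with coordinates $t_1,\dots,t_N$ and character lattice $X=\mathbb{Z}^N$ (characters written multiplicatively). $R_0$ is the root system of type $B_N$ in $X$: short roots $t_i^{\pm1}$ and long roots $t_i^{\pm1}t_j^{\pm1}$ ($i<j$, all signs), with a fixed set $R_0^+$ of positive roots. **Parameters and $\mu$-function.** Let $m_\pm$ be real numbers with $4m_\pm\in\mathbb{Z}$ and $2(m_-\pm m_+)\in\mathbb{Z}$, and let $b=1$ if both $m_+\pm m_-\in\mathbb{Z}$ and $b=2$ otherwise (replacing $m_+$ by $m_+-2$ does not change $b$). Define functions $\mathtt m_\pm$ on $R_0$ by $\mathtt m_+(\alpha)=b$, $\mathtt m_-(\alpha)=0$ for long $\alpha$, and $\mathtt m_+(\alpha)=b\,m_+$, $\mathtt m_-(\alpha)=b\,m_-$ for short $\alpha$. The $\mu$-function with normalisation factor $d=d(v)$ is $$\mu_{\mathtt m,d}=d\,v^{-2\sum_{\alpha\in R_0^+}(\mathtt m_+(\alpha)+\mathtt m_-(\alpha))}\prod_{\alpha\in R_0}\frac{1-\alpha^{-2}}{(1-v^{-2\mathtt m_+(\alpha)}\alpha^{-1})(1+v^{-2\mathtt m_-(\alpha)}\alpha^{-1})}.$$ Write $\mu^N_{m_-,m_+}$ for this function on $T^N$ with $$d=d^N_{m_-,m_+}=(v^{b}-v^{-b})^{-N}\prod_{i=1}^{\lfloor|m_--m_+|\rfloor}\Bigl(\frac{v^{b(|m_--m_+|-i)}}{1+q^{b(|m_--m_+|-i)}}\Bigr)^{i}\prod_{j=1}^{\lfloor|m_-+m_+|\rfloor}\Bigl(\frac{v^{b(|m_-+m_+|-j)}}{1+q^{b(|m_-+m_+|-j)}}\Bigr)^{j}.$$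 **Residual cosets.** Let $L\subset T$ be a coset of a subtorus $T^L\subset T$. Put, for $\epsilon=\pm$, $$p_\epsilon(L)=\{\alpha\in R_0:\epsilon\alpha|_L= v^{-2\mathtt m_\epsilon(\alpha)}\},\qquad z_\epsilon(L)=\{\alpha\in R_0:\epsilon\alpha|_L= 1\}$$ (here $\epsilon\alpha$ means the function $\pm\alpha$, i.e. the character value multiplied by the sign). $L$ is residual if $|p_+(L)|+|p_-(L)|-|z_+(L)|-|z_-(L)|=\operatorname{codim}(L)$. For $L$ residual, the regularisation of $\mu_{\mathtt m,d}$ along $L$ is $$\mu^L_{\mathtt m,d}=\frac{d\,v^{-2\sum_{\alpha\in R_0^+}(\mathtt m_+(\alpha)+\mathtt m_-(\alpha))}\prod_{\alpha\in R_0\setminus z_-(L)}(1+\alpha^{-1})\prod_{\alpha\in R_0\setminus z_+(L)}(1-\alpha^{-1})}{\prod_{\alpha\in R_0\setminus p_-(L)}(1+v^{-2\mathtt m_-(\alpha)}\alpha^{-1})\prod_{\alpha\in R_0\setminus p_+(L)}(1-v^{-2\mathtt m_+(\alpha)}\alpha^{-1})},$$ and $\mu^{(L)}_{\mathtt m,d}$ denotes its restriction to $L$, a nonzero rational function. Let $R_L\subset R_0$ be the set of roots that are constant on $L$, and let $T_L\subset T$ be the subtorus whose cocharacter lattice is $Y\cap\mathbb{Q}R_L^\vee$, where $Y$ is the cocharacter lattice of $T$. **Spectral transfer morphism.** Given two normalised affine Hecke algebras with tori $T_1,T_2$ and $\mu$-functions $\mu_1,\mu_2$, and a residual coset $L\subset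 T_2$ for $\mu_2$, a morphism $\phi_T:T_1\to T_2$ with image $L$ is a spectral transfer morphism if: (T1) $\phi_T$ is a finite morphism of algebraic varieties; (T2) $\phi_T$ maps the identity $e$ of $T_1$ into $L\cap T_L$, and when $\phi_T(e)$ is declared to be the base point (identity) of $L$, $\phi_T$ becomes a homomorphism of algebraic tori; (T3) there is a constant $c\in\mathbb{Q}^\times$, independent of $v$, with $\phi_T^*\bigl(\mu_2^{(L)}\bigr)=c\,\mu_1$. Thus part of the assertion is that the image of the morphism is a residual coset of the target. *)

theory Defs
  imports Complex_Main "HOL-Algebra.Coset"
begin

text \<open>The torus of rank \<open>N\<close>. A point is a function on all of \<open>nat\<close>, padded by \<open>1\<close> at indices
  \<open>\<ge> N\<close>, so that equality of points is equality of functions.\<close>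

definition torus :: "nat \<Rightarrow> (nat \<Rightarrow> complex) monoid" where
  "torus N = \<lparr> carrier = {t. (\<forall>i<N. t i \<noteq> 0) \<and> (\<forall>i\<ge>N. t i = 1)},
               mult = (\<lambda>s t i. s i * t i), one = (\<lambda>i. 1) \<rparr>"

text \<open>\<open>\<int>\<^sup>N\<close>, padded by \<open>0\<close>: it serves both as character and as cocharacter lattice.\<close>

definition lattice_Z :: "nat \<Rightarrow> (nat \<Rightarrow> int) set" where
  "lattice_Z N = {x. \<forall>i\<ge>N. x i = 0}"

definition char_val :: "nat \<Rightarrow> (nat \<Rightarrow> int) \<Rightarrow> (nat \<Rightarrow> complex) \<Rightarrow> complex" where
  "char_val N x t = (\<Prod>i<N. t i powi x i)"

definition cochar_val :: "(nat \<Rightarrow> int) \<Rightarrow> complex \<Rightarrow> nat \<Rightarrow> complex" where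
  "cochar_val y z = (\<lambda>i. z powi y i)"


section \<open>Regular functions, finite morphisms, subtori\<close>

definition regular_functions :: "nat \<Rightarrow> ((nat \<Rightarrow> complex) \<Rightarrow> complex) set" where
  "regular_functions N = {f. \<exists>A c. finite A \<and> A \<subseteq> lattice_Z N \<and>
     (\<forall>t\<in>carrier (torus N). f t = (\<Sum>x\<in>A. c x * char_val N x t))}"

definition torus_morphism ::
  "nat \<Rightarrow> nat \<Rightarrow> ((nat \<Rightarrow> complex) \<Rightarrow> (nat \<Rightarrow> complex)) \<Rightarrow> bool" where
  "torus_morphism k N \<phi> \<longleftrightarrow> \<phi> \<in> carrier (torus k) \<rightarrow> carrier (torus N) \<and>
     (\<forall>f\<in>regular_functions N. f \<circ> \<phi> \<in> regular_functions k)"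

text \<open>A morphism of affine varieties is finite if it makes the coordinate ring of the source a
  finitely generated module over the coordinate ring of the target.\<close>

definition finite_morphism ::
  "nat \<Rightarrow> nat \<Rightarrow> ((nat \<Rightarrow> complex) \<Rightarrow> (nat \<Rightarrow> complex)) \<Rightarrow> bool" where
  "finite_morphism k N \<phi> \<longleftrightarrow> torus_morphism k N \<phi> \<and>
     (\<exists>G. finite G \<and> G \<subseteq> regular_functions k \<and>
        (\<forall>f\<in>regular_functions k. \<exists>a. (\<forall>g\<in>G. a g \<in> regular_functions N) \<and>
           (\<forall>t\<in>carrier (torus k). f t = (\<Sum>g\<in>G. a g (\<phi> t) * g t))))"

text \<open>A subtorus of dimension \<open>k\<close> is the isomorphic image of the torus of rank \<open>k\<close> under a
  homomorphism of algebraic tori; such a homomorphism is given by \<open>k\<close> cocharacters.\<close>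

definition subtorus :: "nat \<Rightarrow> nat \<Rightarrow> (nat \<Rightarrow> complex) set \<Rightarrow> bool" where
  "subtorus N k S \<longleftrightarrow> (\<exists>y. (\<forall>i<k. y i \<in> lattice_Z N) \<and>
     inj_on (\<lambda>s j. \<Prod>i<k. s i powi y i j) (carrier (torus k)) \<and>
     S = (\<lambda>s j. \<Prod>i<k. s i powi y i j) ` carrier (torus k))"

definition subtorus_coset :: "nat \<Rightarrow> nat \<Rightarrow> (nat \<Rightarrow> complex) set \<Rightarrow> bool" where
  "subtorus_coset N k L \<longleftrightarrow>
     (\<exists>S x. subtorus N k S \<and> x \<in> carrier (torus N) \<and> L = x <#\<^bsub>torus N\<^esub> S)"

definition cochar_lattice :: "nat \<Rightarrow> (nat \<Rightarrow> complex) set \<Rightarrow> (nat \<Rightarrow> int) set" where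
  "cochar_lattice N S = {y \<in> lattice_Z N. \<forall>z. z \<noteq> 0 \<longrightarrow> cochar_val y z \<in> S}"

text \<open>The coset \<open>L\<close> of a subgroup of \<open>G\<close>, made into a group with identity \<open>x0 \<in> L\<close>.\<close>

definition based_coset :: "'a monoid \<Rightarrow> 'a set \<Rightarrow> 'a \<Rightarrow> 'a monoid" where
  "based_coset G L x0 =
     \<lparr> carrier = L, mult = (\<lambda>x y. x \<otimes>\<^bsub>G\<^esub> inv\<^bsub>G\<^esub> x0 \<otimes>\<^bsub>G\<^esub> y), one = x0 \<rparr>"


section \<open>The root system of type B\<close>

definition short_roots :: "nat \<Rightarrow> (nat \<Rightarrow> int) set" where
  "short_roots N = {a. \<exists>i s. i < N \<and> s \<in> {1, -1} \<and> a = (\<lambda>k. if k = i then s else 0)}"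

definition long_roots :: "nat \<Rightarrow> (nat \<Rightarrow> int) set" where
  "long_roots N = {a. \<exists>i j s u. i < j \<and> j < N \<and> s \<in> {1, -1} \<and> u \<in> {1, -1} \<and>
     a = (\<lambda>k. if k = i then s else if k = j then u else 0)}"

definition roots_B :: "nat \<Rightarrow> (nat \<Rightarrow> int) set" where
  "roots_B N = short_roots N \<union> long_roots N"

definition positive_system :: "nat \<Rightarrow> (nat \<Rightarrow> int) set \<Rightarrow> bool" where
  "positive_system N P \<longleftrightarrow> P \<subseteq> roots_B N \<and>
     (\<forall>a\<in>roots_B N. (a \<in> P) \<noteq> ((\<lambda>i. - a i) \<in> P)) \<and>
     (\<forall>a\<in>P. \<forall>b\<in>P. (\<lambda>i. a i + b i) \<in> roots_B N \<longrightarrow> (\<lambda>i. a i + b i) \<in> P)"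

text \<open>\<open>2 a / (a, a)\<close> for the standard inner product; the division is exact on roots.\<close>

definition coroot :: "nat \<Rightarrow> (nat \<Rightarrow> int) \<Rightarrow> (nat \<Rightarrow> int)" where
  "coroot N a = (\<lambda>i. (2 * a i) div (\<Sum>j<N. (a j)\<^sup>2))"


section \<open>Normalised affine Hecke algebras and their mu-functions\<close>

text \<open>The data determining a normalised affine Hecke algebra with root system of type B, the torus
  being \<^term>\<open>torus N\<close>. The normalisation factor is a function of \<open>v\<close>.\<close>

record hecke_datum =
  hrank :: nat
  hpos :: "(nat \<Rightarrow> int) set"
  hm_plus :: "(nat \<Rightarrow> int) \<Rightarrow> real"
  hm_minus :: "(nat \<Rightarrow> int) \<Rightarrow> real"
  hnorm :: "real \<Rightarrow> real"

text \<open>Rational functions on an irreducible variety are fractions (numerator, denominator) of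
  regular functions whose denominator does not vanish identically; two fractions are equal if they
  agree after cross-multiplication. Values of quotients are avoided because of \<open>x / 0 = 0\<close>.\<close>

type_synonym fraction = "((nat \<Rightarrow> complex) \<Rightarrow> complex) \<times> ((nat \<Rightarrow> complex) \<Rightarrow> complex)"

definition ratfun_eq :: "(nat \<Rightarrow> complex) set \<Rightarrow> fraction \<Rightarrow> fraction \<Rightarrow> bool" where
  "ratfun_eq S f g \<longleftrightarrow> (\<exists>t\<in>S. snd f t \<noteq> 0) \<and> (\<exists>t\<in>S. snd g t \<noteq> 0) \<and>
     (\<forall>t\<in>S. fst f t * snd g t = fst g t * snd f t)"

definition ratfun_pullback ::
  "((nat \<Rightarrow> complex) \<Rightarrow> (nat \<Rightarrow> complex)) \<Rightarrow> fraction \<Rightarrow> fraction" where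
  "ratfun_pullback \<phi> f = (fst f \<circ> \<phi>, snd f \<circ> \<phi>)"

definition ratfun_scale :: "complex \<Rightarrow> fraction \<Rightarrow> fraction" where
  "ratfun_scale c f = ((\<lambda>t. c * fst f t), snd f)"

definition mu_const :: "hecke_datum \<Rightarrow> real \<Rightarrow> real" where
  "mu_const H v = hnorm H v * v powr (-2 * (\<Sum>a\<in>hpos H. hm_plus H a + hm_minus H a))"

definition mu_fun :: "hecke_datum \<Rightarrow> real \<Rightarrow> fraction" where
  "mu_fun H v = (let N = hrank H; R = roots_B N in
     ((\<lambda>t. of_real (mu_const H v) * (\<Prod>a\<in>R. 1 - inverse ((char_val N a t)\<^sup>2))),
      (\<lambda>t. \<Prod>a\<in>R. (1 - of_real (v powr (-2 * hm_plus H a)) * inverse (char_val N a t)) *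
                   (1 + of_real (v powr (-2 * hm_minus H a)) * inverse (char_val N a t)))))"

definition p_plus :: "hecke_datum \<Rightarrow> real \<Rightarrow> (nat \<Rightarrow> complex) set \<Rightarrow> (nat \<Rightarrow> int) set" where
  "p_plus H v L = {a \<in> roots_B (hrank H).
     \<forall>t\<in>L. char_val (hrank H) a t = of_real (v powr (-2 * hm_plus H a))}"

definition p_minus :: "hecke_datum \<Rightarrow> real \<Rightarrow> (nat \<Rightarrow> complex) set \<Rightarrow> (nat \<Rightarrow> int) set" where
  "p_minus H v L = {a \<in> roots_B (hrank H).
     \<forall>t\<in>L. - char_val (hrank H) a t = of_real (v powr (-2 * hm_minus H a))}"

definition z_plus :: "hecke_datum \<Rightarrow> (nat \<Rightarrow> complex) set \<Rightarrow> (nat \<Rightarrow> int) set" where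
  "z_plus H L = {a \<in> roots_B (hrank H). \<forall>t\<in>L. char_val (hrank H) a t = 1}"

definition z_minus :: "hecke_datum \<Rightarrow> (nat \<Rightarrow> complex) set \<Rightarrow> (nat \<Rightarrow> int) set" where
  "z_minus H L = {a \<in> roots_B (hrank H). \<forall>t\<in>L. - char_val (hrank H) a t = 1}"

definition residual_coset :: "hecke_datum \<Rightarrow> real \<Rightarrow> (nat \<Rightarrow> complex) set \<Rightarrow> bool" where
  "residual_coset H v L \<longleftrightarrow> (\<exists>k. subtorus_coset (hrank H) k L \<and>
     int (card (p_plus H v L)) + int (card (p_minus H v L))
       - int (card (z_plus H L)) - int (card (z_minus H L)) = int (hrank H) - int k)"

definition mu_reg :: "hecke_datum \<Rightarrow> real \<Rightarrow> (nat \<Rightarrow> complex) set \<Rightarrow> fraction" where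
  "mu_reg H v L = (let N = hrank H; R = roots_B N in
     ((\<lambda>t. of_real (mu_const H v) *
        (\<Prod>a\<in>R - z_minus H L. 1 + inverse (char_val N a t)) *
        (\<Prod>a\<in>R - z_plus H L. 1 - inverse (char_val N a t))),
      (\<lambda>t. (\<Prod>a\<in>R - p_minus H v L.
               1 + of_real (v powr (-2 * hm_minus H a)) * inverse (char_val N a t)) *
           (\<Prod>a\<in>R - p_plus H v L.
               1 - of_real (v powr (-2 * hm_plus H a)) * inverse (char_val N a t)))))"

definition constant_roots :: "nat \<Rightarrow> (nat \<Rightarrow> complex) set \<Rightarrow> (nat \<Rightarrow> int) set" where
  "constant_roots N L = {a \<in> roots_B N. \<exists>c. \<forall>t\<in>L. char_val N a t = c}"

text \<open>The intersection of the cocharacter lattice with the rational span of the coroots of \<open>A\<close>.\<close>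

definition coroot_span :: "nat \<Rightarrow> (nat \<Rightarrow> int) set \<Rightarrow> (nat \<Rightarrow> int) set" where
  "coroot_span N A = {y \<in> lattice_Z N.
     \<exists>c :: (nat \<Rightarrow> int) \<Rightarrow> rat. \<forall>i. of_int (y i) = (\<Sum>a\<in>A. c a * of_int (coroot N a i))}"

definition T_sub :: "nat \<Rightarrow> (nat \<Rightarrow> complex) set \<Rightarrow> (nat \<Rightarrow> complex) set" where
  "T_sub N L = (THE S. (\<exists>k. subtorus N k S) \<and>
     cochar_lattice N S = coroot_span N (constant_roots N L))"


section \<open>Spectral transfer morphisms\<close>

text \<open>The map and its image depend on the parameter \<open>v > 1\<close>, whereas the rational constant \<open>c\<close> of
  the last condition does not; so the notion is one of families indexed by \<open>v\<close>. The pullback along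
  \<open>\<phi> v\<close> involves only the restriction of the regularised function to the image of \<open>\<phi> v\<close>.\<close>

definition spectral_transfer_morphism ::
  "hecke_datum \<Rightarrow> hecke_datum \<Rightarrow> (real \<Rightarrow> (nat \<Rightarrow> complex) \<Rightarrow> (nat \<Rightarrow> complex)) \<Rightarrow> bool" where
  "spectral_transfer_morphism H1 H2 \<phi> \<longleftrightarrow>
     (let T1 = torus (hrank H1); T2 = torus (hrank H2); L = (\<lambda>v. \<phi> v ` carrier T1) in
      (\<forall>v>1. residual_coset H2 v (L v) \<and>
             finite_morphism (hrank H1) (hrank H2) (\<phi> v) \<and>
             \<phi> v \<one>\<^bsub>T1\<^esub> \<in> L v \<inter> T_sub (hrank H2) (L v) \<and>
             \<phi> v \<in> hom T1 (based_coset T2 (L v) (\<phi> v \<one>\<^bsub>T1\<^esub>))) \<and>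
      (\<exists>c::rat. c \<noteq> 0 \<and>
         (\<forall>v>1. ratfun_eq (carrier T1)
                  (ratfun_pullback (\<phi> v) (mu_reg H2 v (L v)))
                  (ratfun_scale (of_rat c) (mu_fun H1 v)))))"


section \<open>The specific parameters\<close>

definition b_par :: "real \<Rightarrow> real \<Rightarrow> nat" where
  "b_par mm mp = (if mp + mm \<in> \<int> \<and> mp - mm \<in> \<int> then 1 else 2)"

definition norm_prod :: "nat \<Rightarrow> real \<Rightarrow> real \<Rightarrow> real" where
  "norm_prod b x v = (\<Prod>i = 1..nat \<lfloor>x\<rfloor>.
     (v powr (real b * (x - real i)) / (1 + (v\<^sup>2) powr (real b * (x - real i)))) ^ i)"

definition d_norm :: "nat \<Rightarrow> real \<Rightarrow> real \<Rightarrow> real \<Rightarrow> real" where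
  "d_norm N mm mp v = (let b = b_par mm mp in
     (v powi int b - v powi (- int b)) powi (- int N) *
       norm_prod b \<bar>mm - mp\<bar> v * norm_prod b \<bar>mm + mp\<bar> v)"

definition hecke_B :: "nat \<Rightarrow> (nat \<Rightarrow> int) set \<Rightarrow> real \<Rightarrow> real \<Rightarrow> hecke_datum" where
  "hecke_B N P mm mp = (let b = real (b_par mm mp) in
     \<lparr> hrank = N, hpos = P,
       hm_plus = (\<lambda>a. if a \<in> long_roots N then b else b * mp),
       hm_minus = (\<lambda>a. if a \<in> long_roots N then 0 else b * mm),
       hnorm = d_norm N mm mp \<rparr>)"

definition psi_T :: "nat \<Rightarrow> real \<Rightarrow> nat \<Rightarrow> real \<Rightarrow> (nat \<Rightarrow> complex) \<Rightarrow> (nat \<Rightarrow> complex)" where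
  "psi_T n mm mp v t = (\<lambda>i.
     if i < n then t i
     else if i < n + 2 * mp - 2
       then of_real ((v\<^sup>2) ^ (b_par mm (real mp) * ((i - n + 1) div 2)))
     else 1)"

end

theory Submission
  imports Defs
begin

text \<open>
  Write \<open>p = m\<^sub>+ - 1\<close> and \<open>q = v\<^bsup>2b\<^esup>\<close>, so that the last \<open>2p\<close> coordinates of a point of the image \<open>L\<close>
  are the positive real numbers \<open>q\<^bsup>e\<^esup>\<close> with \<open>e\<close> running through \<open>0, 1, 1, 2, 2, \<dots>, p - 1, p - 1, p\<close>.
  The roots of the target are of three kinds: head roots, involving only the first \<open>n\<close> coordinates,
  mixed roots, and tail roots, involving only the last \<open>2p\<close>. Exactly the tail roots are constant on
  \<open>L\<close>, with positive values that are powers of \<open>q\<close>. Hence \<open>p\<^sub>-(L)\<close> and \<open>z\<^sub>-(L)\<close> are empty, and every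
  remaining question is about products over the three kinds of roots.

  The combinatorial heart is that the multiset of all numbers \<open>\<plusminus>e\<close> is the union of the two
  intervals \<open>[-p, p - 1]\<close> and \<open>[1 - p, p]\<close>. A product of quotients \<open>f (c \<plusminus> e) / f (c \<plusminus> e - 1)\<close>
  therefore telescopes, whatever the function \<open>f\<close> is (lemmas \<open>telescope\<close> and \<open>telescope_even\<close>).
  This identity serves for several choices of \<open>f\<close>.

  With \<open>f k = 1 - x q\<^bsup>k\<^esup>\<close> the mixed roots over one head coordinate \<open>x\<close> collapse to the factor that turns
  the parameter \<open>m\<^sub>+ - 2\<close> of the short head roots into \<open>m\<^sub>+\<close> (\<open>mixed_telescope\<close>).

  The tail roots contribute a constant, computed by induction on \<open>p\<close>. Passing from \<open>p\<close> to \<open>p + 1\<close>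
  adds the exponents \<open>p\<close> and \<open>p + 1\<close>, whose interaction with the earlier ones telescopes
  (\<open>tail_short_Suc\<close>, \<open>tail_long_Suc\<close>). For \<open>f k = 1 - q\<^bsup>k\<^esup>\<close>, with the zero factor replaced by \<open>1\<close>, this
  gives a monomial in \<open>q\<close> and \<open>q - 1\<close>, up to a factor \<open>4\<close> (\<open>tail_value\<close>). For \<open>f\<close> equal to \<open>2\<close> at \<open>0\<close> and
  to \<open>1\<close> elsewhere it counts vanishing factors instead, and shows that \<open>L\<close> is residual (\<open>tail_order\<close>).

  Finally, the parameter \<open>m\<^sub>-\<close> enters the tail through the factors \<open>1 + q\<^bsup>-m\<^sub>-\<plusminus>e\<^esup>\<close>. The normalisation
  product, as an even function of its argument, has as its multiplicative second differences the
  inverses of such factors, up to powers of \<open>v\<close> and a factor \<open>1/2\<close> at the argument \<open>0\<close>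
  (\<open>norm_prod_second_difference\<close>). The same multiset identity then evaluates their product as the quotient of the two normalisation products
  (\<open>norm_prod_ratio\<close>). All powers of \<open>v\<close>, \<open>q\<close> and \<open>q - 1\<close> cancel (\<open>constant_identity\<close>); what remains is
  a rational constant, assembled from the factor \<open>4\<close> and the factors \<open>1/2\<close>.
\<close>

section \<open>Telescoping over the exponents of the tail\<close>

definition expo :: "nat \<Rightarrow> int" where "expo k = int ((k + 1) div 2)"

lemma expo_even [simp]: "expo (2 * p) = int p" and expo_odd [simp]: "expo (Suc (2 * p)) = int p + 1"
  by (auto simp: expo_def)

lemma prod_lessThan_double_Suc:
  "(\<Prod>k<2 * Suc p. g k) = (\<Prod>k<2 * p. g k) * (g (2 * p) * g (Suc (2 * p)))"
  for g :: "nat \<Rightarrow> 'a :: comm_monoid_mult"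
  by (simp add: mult.assoc)

text \<open>Both sides list the values of \<open>f\<close> at \<open>c\<close> plus the same multiset, because the numbers
  \<open>\<plusminus>expo k\<close> fill the intervals \<open>[-p, p - 1]\<close> and \<open>[1 - p, p]\<close>. No division is involved, so the values
  of \<open>f\<close> may vanish.\<close>
lemma telescope:
  fixes f :: "int \<Rightarrow> 'a :: comm_monoid_mult"
  shows "(\<Prod>k<2 * p. f (c + expo k) * f (c - expo k)) * (f (c - int p - 1) * f (c - int p))
       = (\<Prod>k<2 * p. f (c + expo k - 1) * f (c - expo k - 1)) * (f (c + int p - 1) * f (c + int p))"
proof (induction p)
  case (Suc p)
  let ?A = "\<Prod>k<2 * p. f (c + expo k) * f (c - expo k)"
  let ?B = "\<Prod>k<2 * p. f (c + expo k - 1) * f (c - expo k - 1)"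
  have "(\<Prod>k<2 * Suc p. f (c + expo k) * f (c - expo k)) * (f (c - int (Suc p) - 1) * f (c - int (Suc p)))
     = ?A * (f (c - int p - 1) * f (c - int p)) *
       (f (c + int p) * f (c + int p + 1) * f (c - int p - 2) * f (c - int p - 1))"
    by (simp only: prod_lessThan_double_Suc expo_even expo_odd) (simp add: algebra_simps)
  also have "\<dots> = ?B * (f (c + int p - 1) * f (c + int p)) *
       (f (c + int p) * f (c + int p + 1) * f (c - int p - 2) * f (c - int p - 1))"
    by (simp only: Suc.IH)
  also have "\<dots> = (\<Prod>k<2 * Suc p. f (c + expo k - 1) * f (c - expo k - 1)) *
       (f (c + int (Suc p) - 1) * f (c + int (Suc p)))"
    by (simp only: prod_lessThan_double_Suc expo_even expo_odd) (simp add: algebra_simps)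
  finally show ?case .
qed (simp add: algebra_simps)

text \<open>The contribution of the short tail roots, for an arbitrary function \<open>f\<close> of the exponent of
  the root value: the numerator comes from \<open>1 - 1/\<alpha>\<close>, and the denominator from the factor with parameter
  \<open>m\<^sub>+ - 2 = p - 1\<close>. In \<open>tail_long\<close> below the parameter of the long roots is \<open>1\<close> instead.\<close>
definition tail_short :: "(int \<Rightarrow> real) \<Rightarrow> nat \<Rightarrow> real" where
  "tail_short f p = (\<Prod>k<2 * p. f (expo k) * f (- expo k) /
     (f (1 - int p + expo k) * f (1 - int p - expo k)))"

definition pair_quot :: "(int \<Rightarrow> real) \<Rightarrow> int \<Rightarrow> int \<Rightarrow> real" where
  "pair_quot f x y = f (y + x) * f (y - x) * f (- y + x) * f (- y - x) /
     (f (y + x - 1) * f (y - x - 1) * f (- y + x - 1) * f (- y - x - 1))"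

definition tail_long :: "(int \<Rightarrow> real) \<Rightarrow> nat \<Rightarrow> real" where
  "tail_long f p = (\<Prod>k<2 * p. \<Prod>l<k. pair_quot f (expo l) (expo k))"

text \<open>The interaction of one new exponent \<open>y\<close> with all earlier ones telescopes, once for each sign
  of \<open>y\<close>.\<close>
lemma prod_pair_quot:
  assumes nz: "\<And>k. f k \<noteq> 0"
  shows "(\<Prod>l<2 * p. pair_quot f (expo l) y) =
    f (y + int p - 1) * f (y + int p) / (f (y - int p - 1) * f (y - int p)) *
    (f (- y + int p - 1) * f (- y + int p) / (f (- y - int p - 1) * f (- y - int p)))"
proof -
  have H: "(\<Prod>k<2 * p. f (c + expo k) * f (c - expo k)) / (\<Prod>k<2 * p. f (c + expo k - 1) * f (c - expo k - 1))
      = f (c + int p - 1) * f (c + int p) / (f (c - int p - 1) * f (c - int p))" for c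
    using telescope[where f=f and c=c and p=p] nz by (simp add: frac_eq_eq)
  have "(\<Prod>l<2 * p. pair_quot f (expo l) y) =
    (\<Prod>l<2 * p. f (y + expo l) * f (y - expo l) / (f (y + expo l - 1) * f (y - expo l - 1)) *
      (f (- y + expo l) * f (- y - expo l) / (f (- y + expo l - 1) * f (- y - expo l - 1))))"
    by (rule prod.cong) (simp_all add: pair_quot_def)
  also have "\<dots> = (\<Prod>k<2 * p. f (y + expo k) * f (y - expo k)) / (\<Prod>k<2 * p. f (y + expo k - 1) * f (y - expo k - 1)) *
     ((\<Prod>k<2 * p. f (- y + expo k) * f (- y - expo k)) / (\<Prod>k<2 * p. f (- y + expo k - 1) * f (- y - expo k - 1)))"
    by (simp only: prod.distrib prod_dividef)
  finally show ?thesis by (simp only: H)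
qed

text \<open>The denominator of \<open>tail_short\<close> depends on \<open>p\<close> also through its shift; \<open>telescope\<close> with
  \<open>c = 1 - p\<close> compares the two shifts.\<close>
lemma tail_short_Suc:
  assumes nz: "\<And>k. f k \<noteq> 0"
  shows "tail_short f (Suc p) = tail_short f p *
    (f (int p) * f (- int p) * f (int p + 1) * f (- int p - 1) /
     ((f (- 2 * int p))\<^sup>2 * f (1 - 2 * int p) * f (- 1 - 2 * int p)))"
proof -
  let ?c = "1 - int p"
  have D: "(\<Prod>k<2 * p. f (?c + expo k - 1) * f (?c - expo k - 1)) =
     (\<Prod>k<2 * p. f (?c + expo k) * f (?c - expo k)) * (f (- 2 * int p) * f (1 - 2 * int p)) / (f 0 * f 1)"
    using telescope[where f=f and c="?c" and p=p] nz by (simp add: field_simps)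
  have "tail_short f (Suc p) = (\<Prod>k<2 * Suc p. f (expo k) * f (- expo k)) /
     (\<Prod>k<2 * Suc p. f (?c + expo k - 1) * f (?c - expo k - 1))"
  proof -
    have "1 - int (Suc p) + e = ?c + e - 1" "1 - int (Suc p) - e = ?c - e - 1" for e by simp_all
    then show ?thesis unfolding tail_short_def prod_dividef by simp
  qed
  also have "\<dots> = (\<Prod>k<2 * p. f (expo k) * f (- expo k)) * (f (int p) * f (- int p) * (f (int p + 1) * f (- int p - 1))) /
     ((\<Prod>k<2 * p. f (?c + expo k - 1) * f (?c - expo k - 1)) *
       (f 0 * f (- 2 * int p) * (f 1 * f (- 1 - 2 * int p))))"
  proof -
    have "?c + int p - 1 = 0" "?c - int p - 1 = - 2 * int p" "?c + (int p + 1) - 1 = 1"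
      "?c - (int p + 1) - 1 = - 1 - 2 * int p" "- (int p + 1) = - int p - 1" by simp_all
    then show ?thesis by (simp only: prod_lessThan_double_Suc expo_even expo_odd)
  qed
  also have "\<dots> = (\<Prod>k<2 * p. f (expo k) * f (- expo k)) / (\<Prod>k<2 * p. f (?c + expo k) * f (?c - expo k)) *
    (f (int p) * f (- int p) * f (int p + 1) * f (- int p - 1) /
     ((f (- 2 * int p))\<^sup>2 * f (1 - 2 * int p) * f (- 1 - 2 * int p)))"
    unfolding D using nz by (simp add: field_simps power2_eq_square)
  finally show ?thesis unfolding tail_short_def prod_dividef .
qed

lemma tail_long_Suc:
  assumes nz: "\<And>k. f k \<noteq> 0"
  shows "tail_long f (Suc p) = tail_long f p *
    (f (2 * int p - 1) * f (2 * int p) * (f (2 * int p + 1))\<^sup>2 * (f (- 1))\<^sup>2 /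
     (f (- 2 * int p) * f (- 1 - 2 * int p) * (f (- 2 - 2 * int p))\<^sup>2 * (f 0)\<^sup>2))"
proof -
  have step: "tail_long f (Suc p) = tail_long f p *
    ((\<Prod>l<2 * p. pair_quot f (expo l) (int p)) *
     ((\<Prod>l<2 * p. pair_quot f (expo l) (int p + 1)) * pair_quot f (int p) (int p + 1)))"
    unfolding tail_long_def prod_lessThan_double_Suc by (simp add: mult.assoc)
  have first: "(\<Prod>l<2 * p. pair_quot f (expo l) (int p)) =
     f (2 * int p - 1) * f (2 * int p) / (f (- 1 - 2 * int p) * f (- 2 * int p))"
  proof -
    have "int p + int p - 1 = 2 * int p - 1" "int p + int p = 2 * int p" "int p - int p - 1 = - 1"
      "int p - int p = 0" "- int p + int p - 1 = - 1" "- int p + int p = 0"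
      "- int p - int p - 1 = - 1 - 2 * int p" "- int p - int p = - 2 * int p"
      by simp_all
    then show ?thesis using nz by (simp only: prod_pair_quot[OF nz]) simp
  qed
  have second: "(\<Prod>l<2 * p. pair_quot f (expo l) (int p + 1)) =
     f (2 * int p) * f (2 * int p + 1) * (f (- 2) * f (- 1)) /
     (f 0 * f 1 * (f (- 2 - 2 * int p) * f (- 1 - 2 * int p)))"
  proof -
    have "int p + 1 + int p - 1 = 2 * int p" "int p + 1 + int p = 2 * int p + 1"
      "int p + 1 - int p - 1 = 0" "int p + 1 - int p = 1"
      "- (int p + 1) + int p - 1 = - 2" "- (int p + 1) + int p = - 1"
      "- (int p + 1) - int p - 1 = - 2 - 2 * int p" "- (int p + 1) - int p = - 1 - 2 * int p"
      by simp_all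
    then show ?thesis by (simp only: prod_pair_quot[OF nz] times_divide_times_eq)
  qed
  have new: "pair_quot f (int p) (int p + 1) =
     f (2 * int p + 1) * f 1 * f (- 1) * f (- 1 - 2 * int p) /
     (f (2 * int p) * f 0 * f (- 2) * f (- 2 - 2 * int p))"
  proof -
    have "int p + 1 + int p = 2 * int p + 1" "int p + 1 - int p = 1"
      "- (int p + 1) + int p = - 1" "- (int p + 1) - int p = - 1 - 2 * int p"
      "2 * int p + 1 - 1 = 2 * int p" "- 1 - 1 = (- 2 :: int)" "1 - 1 = (0 :: int)"
      "- 1 - 2 * int p - 1 = - 2 - 2 * int p"
      by simp_all
    then show ?thesis by (simp only: pair_quot_def)
  qed
  show ?thesis
    unfolding step first second new using nz by (simp add: divide_simps power2_eq_square mult_ac)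
qed

text \<open>With this \<open>f\<close> a product of values of \<open>f\<close> is \<open>2\<close> to the number of vanishing arguments. The
  lemma thus says that the denominator has \<open>2p\<close> more vanishing factors than the numerator.\<close>
lemma tail_order:
  fixes f :: "int \<Rightarrow> real"
  defines "f \<equiv> \<lambda>k. if k = 0 then 2 else 1"
  shows "tail_short f p * tail_long f p * 4 ^ p = 1"
proof (induction p)
  case 0
  then show ?case by (simp add: tail_short_def tail_long_def)
next
  case (Suc p)
  have nz: "f k \<noteq> 0" for k by (simp add: f_def)
  have e: "tail_short f (Suc p) * tail_long f (Suc p) * 4 = tail_short f p * tail_long f p"
    unfolding tail_short_Suc[of f, OF nz] tail_long_Suc[of f, OF nz]
    by (cases "p = 0") (auto simp: f_def power2_eq_square)
  have "tail_short f (Suc p) * tail_long f (Suc p) * 4 ^ Suc p =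
      tail_short f (Suc p) * tail_long f (Suc p) * 4 * 4 ^ p" by simp
  with e show ?case using Suc.IH by (simp only:)
qed

section \<open>The value of the tail\<close>

text \<open>The factor \<open>1 - q\<^bsup>k\<^esup>\<close>, with the convention by which the regularised \<open>\<mu>\<close>-function omits the
  factors that vanish identically.\<close>

definition reg_factor :: "real \<Rightarrow> int \<Rightarrow> real" where "reg_factor q k = (if k = 0 then 1 else 1 - q powi k)"

lemma powi_eq_one_real:
  fixes q :: real assumes "q > 1" shows "q powi k = 1 \<longleftrightarrow> k = 0"
  using assms by (metis less_irrefl power_int_0_right power_int_strict_increasing linorder_less_linear)

lemma reg_factor_nonzero: "q > 1 \<Longrightarrow> reg_factor q k \<noteq> 0"
  by (auto simp: reg_factor_def powi_eq_one_real)

lemma reg_factor_minus: "q > 1 \<Longrightarrow> k \<noteq> 0 \<Longrightarrow> reg_factor q (- k) = - reg_factor q k / q powi k"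
  by (simp add: reg_factor_def field_simps power_int_minus)

lemma reg_factor_double: "q > 1 \<Longrightarrow> k \<noteq> 0 \<Longrightarrow> (1 + q powi k) * reg_factor q k = reg_factor q (2 * k)"
  by (simp add: reg_factor_def algebra_simps power_int_mult power2_eq_square mult_2 power_int_add)

definition tail_plus :: "real \<Rightarrow> nat \<Rightarrow> real" where
  "tail_plus q p = (\<Prod>k<2 * p. (1 + q powi expo k) * (1 + q powi (- expo k)))"

lemma tail_plus_Suc:
  "tail_plus q (Suc p) = tail_plus q p * ((1 + q powi int p) * (1 + q powi (- int p)) *
     ((1 + q powi (int p + 1)) * (1 + q powi (- (int p + 1)))))"
  unfolding tail_plus_def prod_lessThan_double_Suc expo_even expo_odd by simp

text \<open>The cancellation behind the next lemma, with \<open>y = q\<^bsup>2(p + 1)\<^esup>\<close> and \<open>a\<close>, \<open>b\<close>, \<open>c\<close>, \<open>d\<close> for the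
  regularised factors at \<open>2(p + 1) + j\<close> for \<open>j = 0, -1, 1, 2\<close>.\<close>
lemma tail_value_step_algebra:
  fixes a b c d q y :: real
  assumes "a \<noteq> 0" "b \<noteq> 0" "c \<noteq> 0" "d \<noteq> 0" "q \<noteq> 0" "y \<noteq> 0"
  shows "a * (- a / y) * d * (- d / (y * q\<^sup>2)) / ((- a / y)\<^sup>2 * (- b / (y / q)) * (- c / (y * q))) *
    (b * a * c\<^sup>2 * ((q - 1) / q)\<^sup>2 / ((- a / y) * (- c / (y * q)) * (- d / (y * q\<^sup>2))\<^sup>2 * 1\<^sup>2)) = y ^ 6 * q * (q - 1)\<^sup>2"
proof -
  have A: "a * (- a / y) * d * (- d / (y * q\<^sup>2)) / ((- a / y)\<^sup>2 * (- b / (y / q)) * (- c / (y * q))) = d\<^sup>2 * y\<^sup>2 / (q\<^sup>2 * b * c)"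
    using assms by (simp add: field_simps power2_eq_square)
  have "b * a * c\<^sup>2 * ((q - 1) / q)\<^sup>2 / ((- a / y) * (- c / (y * q)) * (- d / (y * q\<^sup>2))\<^sup>2 * 1\<^sup>2) =
    b * a * c\<^sup>2 * ((q - 1)\<^sup>2 / q\<^sup>2) / (a * c * d\<^sup>2 / (y ^ 4 * q ^ 5))"
    by (simp add: power_divide power_mult_distrib) (simp add: power2_eq_square eval_nat_numeral mult_ac)
  also have "\<dots> = b * c * (q - 1)\<^sup>2 * y ^ 4 * q ^ 3 / d\<^sup>2"
    using assms by (simp add: divide_simps) (simp add: power2_eq_square eval_nat_numeral mult_ac)
  finally show ?thesis unfolding A
    using assms by (simp add: divide_simps) (simp add: power2_eq_square eval_nat_numeral mult_ac)
qed

text \<open>The step starts at \<open>p + 1 \<ge> 1\<close>: the functional equation \<open>reg_factor_minus\<close> fails at \<open>0\<close>, which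
  is an argument in the step from \<open>0\<close> to \<open>1\<close>. That step is where the factor \<open>4\<close> of \<open>tail_value\<close> arises.\<close>
lemma tail_value_step:
  fixes p :: nat assumes q: "q > 1"
  shows "tail_plus q (Suc (Suc p)) * tail_short (reg_factor q) (Suc (Suc p)) * tail_long (reg_factor q) (Suc (Suc p)) =
    tail_plus q (Suc p) * tail_short (reg_factor q) (Suc p) * tail_long (reg_factor q) (Suc p) * (q ^ (12 * p + 13) * (q - 1)\<^sup>2)"
proof -
  define P where "P = int (Suc p)"
  have P: "P > 0" by (simp add: P_def)
  have nz: "reg_factor q k \<noteq> 0" for k using reg_factor_nonzero[OF q] .
  have [simp]: "q \<noteq> 0" using q by simp
  \<comment> \<open>with \<open>x\<close> as a new variable the claim is an identity of rational functions\<close>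
  define x where "x = q powi P"
  have x: "x \<noteq> 0" by (simp add: x_def)
  have sq: "q powi (2 * P) = x\<^sup>2"
    using power_int_mult[of q P 2] by (simp add: x_def mult.commute)
  have x2: "q powi (2 * P) = x\<^sup>2" "q powi (2 * P - 1) = x\<^sup>2 / q" "q powi (2 * P + 1) = x\<^sup>2 * q"
    "q powi (2 * P + 2) = x\<^sup>2 * q\<^sup>2" "q powi (P + 1) = x * q"
    by (simp_all add: power_int_add power_int_diff sq) (simp add: x_def)
  have neg: "reg_factor q (- 2 * P) = - reg_factor q (2 * P) / x\<^sup>2" "reg_factor q (1 - 2 * P) = - reg_factor q (2 * P - 1) / (x\<^sup>2 / q)"
     "reg_factor q (- 1 - 2 * P) = - reg_factor q (2 * P + 1) / (x\<^sup>2 * q)" "reg_factor q (- 2 - 2 * P) = - reg_factor q (2 * P + 2) / (x\<^sup>2 * q\<^sup>2)"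
  proof -
    have "- 2 * P = - (2 * P)" "1 - 2 * P = - (2 * P - 1)" "- 1 - 2 * P = - (2 * P + 1)" "- 2 - 2 * P = - (2 * P + 2)"
      by simp_all
    moreover have "2 * P \<noteq> 0" "2 * P - 1 \<noteq> 0" "2 * P + 1 \<noteq> 0" "2 * P + 2 \<noteq> 0" using P by auto
    ultimately show "reg_factor q (- 2 * P) = - reg_factor q (2 * P) / x\<^sup>2" "reg_factor q (1 - 2 * P) = - reg_factor q (2 * P - 1) / (x\<^sup>2 / q)"
      "reg_factor q (- 1 - 2 * P) = - reg_factor q (2 * P + 1) / (x\<^sup>2 * q)" "reg_factor q (- 2 - 2 * P) = - reg_factor q (2 * P + 2) / (x\<^sup>2 * q\<^sup>2)"
      by (simp_all only: reg_factor_minus[OF q] x2 not_False_eq_True)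
  qed
  have dbl: "(1 + q powi P) * reg_factor q P = reg_factor q (2 * P)" "(1 + q powi (- P)) * reg_factor q (- P) = reg_factor q (- 2 * P)"
     "(1 + q powi (P + 1)) * reg_factor q (P + 1) = reg_factor q (2 * P + 2)"
     "(1 + q powi (- (P + 1))) * reg_factor q (- (P + 1)) = reg_factor q (- 2 - 2 * P)"
    using reg_factor_double[OF q, of P] reg_factor_double[OF q, of "- P"] reg_factor_double[OF q, of "P + 1"]
       reg_factor_double[OF q, of "- (P + 1)"] P by (simp_all add: algebra_simps)
  have W0: "reg_factor q 0 = 1" "reg_factor q (- 1) = (q - 1) / q"
    by (simp_all add: reg_factor_def power_int_minus field_simps)
  have "tail_plus q (Suc (Suc p)) * tail_short (reg_factor q) (Suc (Suc p)) * tail_long (reg_factor q) (Suc (Suc p)) =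
    tail_plus q (Suc p) * tail_short (reg_factor q) (Suc p) * tail_long (reg_factor q) (Suc p) *
    ((((1 + q powi P) * reg_factor q P) * ((1 + q powi (- P)) * reg_factor q (- P)) *
      ((1 + q powi (P + 1)) * reg_factor q (P + 1)) * ((1 + q powi (- (P + 1))) * reg_factor q (- (P + 1))) /
     ((reg_factor q (- 2 * P))\<^sup>2 * reg_factor q (1 - 2 * P) * reg_factor q (- 1 - 2 * P))) *
     (reg_factor q (2 * P - 1) * reg_factor q (2 * P) * (reg_factor q (2 * P + 1))\<^sup>2 * (reg_factor q (- 1))\<^sup>2 /
     (reg_factor q (- 2 * P) * reg_factor q (- 1 - 2 * P) * (reg_factor q (- 2 - 2 * P))\<^sup>2 * (reg_factor q 0)\<^sup>2)))"
    unfolding tail_plus_Suc[of q "Suc p"] tail_short_Suc[of "reg_factor q" "Suc p", OF nz] tail_long_Suc[of "reg_factor q" "Suc p", OF nz]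
      P_def[symmetric] by simp
  also have "(((1 + q powi P) * reg_factor q P) * ((1 + q powi (- P)) * reg_factor q (- P)) *
      ((1 + q powi (P + 1)) * reg_factor q (P + 1)) * ((1 + q powi (- (P + 1))) * reg_factor q (- (P + 1))) /
     ((reg_factor q (- 2 * P))\<^sup>2 * reg_factor q (1 - 2 * P) * reg_factor q (- 1 - 2 * P))) *
     (reg_factor q (2 * P - 1) * reg_factor q (2 * P) * (reg_factor q (2 * P + 1))\<^sup>2 * (reg_factor q (- 1))\<^sup>2 /
     (reg_factor q (- 2 * P) * reg_factor q (- 1 - 2 * P) * (reg_factor q (- 2 - 2 * P))\<^sup>2 * (reg_factor q 0)\<^sup>2)) = (x\<^sup>2) ^ 6 * q * (q - 1)\<^sup>2"
    unfolding dbl neg W0 using nz x by (intro tail_value_step_algebra) simp_all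
  also have "(x\<^sup>2) ^ 6 * q = q ^ (12 * p + 13)"
    by (simp add: x_def P_def power_int_def nat_add_distrib power_mult[symmetric] power_add[symmetric] power_Suc2[symmetric] add.commute[of 13] del: power_Suc)
  finally show ?thesis by simp
qed

lemma tail_value:
  assumes q: "q > 1"
  shows "tail_plus q p * tail_short (reg_factor q) p * tail_long (reg_factor q) p =
    (if p = 0 then 1 else 4) * q powi (int p * (6 * int p - 5)) * (q - 1) ^ (2 * p)"
proof (cases p)
  case 0
  then show ?thesis by (simp add: tail_plus_def tail_short_def tail_long_def)
next
  case (Suc k)
  have [simp]: "q \<noteq> 0" using q by simp
  have "tail_plus q (Suc k) * tail_short (reg_factor q) (Suc k) * tail_long (reg_factor q) (Suc k) =
    4 * q powi (int (Suc k) * (6 * int (Suc k) - 5)) * (q - 1) ^ (2 * Suc k)"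
  proof (induction k)
    case 0
    have nz: "reg_factor q k \<noteq> 0" for k using reg_factor_nonzero[OF q] .
    have w: "reg_factor q 1 = 1 - q" "reg_factor q (- 1) = (q - 1) / q" "reg_factor q 0 = 1" "reg_factor q (- 2) = (q - 1) * (q + 1) / q\<^sup>2"
      by (simp_all add: reg_factor_def power_int_minus field_simps power2_eq_square)
    have "tail_plus q (Suc 0) = 4 * ((1 + q) * (1 + 1 / q))"
      unfolding tail_plus_Suc[of q 0] by (simp add: tail_plus_def power_int_minus field_simps)
    moreover have "tail_short (reg_factor q) (Suc 0) = 1"
      unfolding tail_short_Suc[of "reg_factor q" 0, OF nz] using q by (simp add: tail_short_def w)
    moreover have "tail_long (reg_factor q) (Suc 0) = (q - 1)\<^sup>2 * q\<^sup>2 / (q + 1)\<^sup>2"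
      unfolding tail_long_Suc[of "reg_factor q" 0, OF nz] using q
      by (simp add: tail_long_def w power_divide power_mult_distrib) (simp add: divide_simps power2_commute)
    moreover have "4 * ((1 + q) * (1 + 1 / q)) * 1 * ((q - 1)\<^sup>2 * q\<^sup>2 / (q + 1)\<^sup>2) = 4 * q * (q - 1)\<^sup>2"
      using q by (simp add: divide_simps) (simp add: power2_eq_square algebra_simps)
    ultimately show ?case by simp
  next
    case (Suc k)
    have "q powi (int (Suc k) * (6 * int (Suc k) - 5)) * q ^ (12 * k + 13) =
      q powi (int (Suc (Suc k)) * (6 * int (Suc (Suc k)) - 5))"
      unfolding power_int_of_nat[symmetric] by (subst power_int_add[symmetric]) (simp_all add: algebra_simps)
    then show ?case
      unfolding tail_value_step[OF q] Suc.IH by (simp add: power2_eq_square mult_ac)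
  qed
  then show ?thesis using Suc by simp
qed

section \<open>Second differences of the normalisation product\<close>

text \<open>This is \<open>1 / (v\<^bsup>by\<^esup> + v\<^bsup>-by\<^esup>)\<close>, hence an even function of \<open>y\<close>.\<close>

definition norm_factor :: "nat \<Rightarrow> real \<Rightarrow> real \<Rightarrow> real" where
  "norm_factor b v y = v powr (real b * y) / (1 + (v\<^sup>2) powr (real b * y))"

lemma norm_factor_pos: "v > 0 \<Longrightarrow> norm_factor b v y > 0"
  by (simp add: norm_factor_def add_pos_pos)

lemma norm_factor_minus: assumes "v > 0" shows "norm_factor b v (- y) = norm_factor b v y"
proof -
  have "(v\<^sup>2) powr a = (v powr a)\<^sup>2" for a
    using assms by (simp add: power2_eq_square powr_mult)
  then show ?thesis
    using assms by (simp add: norm_factor_def powr_minus divide_simps power2_eq_square)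
qed

lemma norm_prod_g: "norm_prod b x v = (\<Prod>i = 1..nat \<lfloor>x\<rfloor>. norm_factor b v (x - real i) ^ i)"
  by (simp add: norm_prod_def norm_factor_def)

lemma norm_prod_pos: "v > 0 \<Longrightarrow> norm_prod b x v > 0"
  unfolding norm_prod_g by (intro prod_pos zero_less_power ballI norm_factor_pos)

text \<open>The exponent \<open>i\<close> in the definition of \<open>norm_prod\<close> makes the first difference an ordinary product
  and the second difference a single factor.\<close>
lemma norm_prod_add_one:
  assumes "x \<ge> 0"
  shows "norm_prod b (x + 1) v = norm_prod b x v * (\<Prod>i\<le>nat \<lfloor>x\<rfloor>. norm_factor b v (x - real i))"
proof -
  let ?M = "nat \<lfloor>x\<rfloor>"
  have "nat \<lfloor>x + 1\<rfloor> = Suc ?M" using assms by (simp add: nat_add_distrib)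
  then have "norm_prod b (x + 1) v = (\<Prod>i = Suc 0..Suc ?M. norm_factor b v (x + 1 - real i) ^ i)"
    by (simp add: norm_prod_g)
  also have "\<dots> = (\<Prod>i = 0..?M. norm_factor b v (x - real i) ^ Suc i)"
    by (subst prod.shift_bounds_cl_Suc_ivl) simp
  also have "\<dots> = (\<Prod>i = 0..?M. norm_factor b v (x - real i) ^ i) * (\<Prod>i = 0..?M. norm_factor b v (x - real i))"
    by (simp add: prod.distrib mult.commute)
  also have "(\<Prod>i = 0..?M. norm_factor b v (x - real i) ^ i) = (\<Prod>i = 1..?M. norm_factor b v (x - real i) ^ i)"
    by (simp add: prod.atLeast_Suc_atMost)
  finally show ?thesis by (simp add: norm_prod_g atLeast0AtMost)
qed

text \<open>For \<open>x \<ge> 1\<close> both first differences are products over one residue class modulo \<open>1\<close>, which differ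
  by the factor at \<open>x\<close>. Since \<open>x\<close> is a half-integer, only \<open>x = 0\<close> and \<open>x = 1/2\<close> remain up to sign. At
  \<open>x = 0\<close> both neighbours contribute \<open>1/2\<close>, while \<open>norm_factor b v 0 = 1/2\<close>.\<close>
lemma norm_prod_second_difference:
  assumes v: "v > 0" and half: "2 * x \<in> \<int>"
  shows "norm_prod b (abs (x + 1)) v * norm_prod b (abs (x - 1)) v =
    (norm_prod b (abs x) v)\<^sup>2 * (norm_factor b v x * (if x = 0 then 1 / 2 else 1))"
proof -
  have nonneg: "norm_prod b (abs (x + 1)) v * norm_prod b (abs (x - 1)) v =
    (norm_prod b (abs x) v)\<^sup>2 * (norm_factor b v x * (if x = 0 then 1 / 2 else 1))"
    if half: "2 * x \<in> \<int>" and "x \<ge> 0" for x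
  proof -
    obtain k :: int where k: "2 * x = of_int k" using half by (auto elim: Ints_cases)
    consider "x = 0" | "x = 1 / 2" | "x \<ge> 1"
    proof -
      have "k = 0 \<or> k = 1 \<or> k \<ge> 2" using k \<open>x \<ge> 0\<close> by linarith
      then show thesis using k that by force
    qed
    then show ?thesis
    proof cases
      case 1
      then show ?thesis using v by (simp add: norm_prod_g norm_factor_def)
    next
      case 2
      have "norm_prod b (3 / 2) v = norm_factor b v (1 / 2)" "norm_prod b (1 / 2) v = 1"
        by (simp_all add: norm_prod_g)
      then show ?thesis by (simp add: 2)
    next
      case 3
      define y where "y = x - 1"
      have y: "y \<ge> 0" "x = y + 1" using 3 by (auto simp: y_def)
      have "(\<Prod>i\<le>nat \<lfloor>x\<rfloor>. norm_factor b v (x - real i)) = (\<Prod>i\<le>Suc (nat \<lfloor>y\<rfloor>). norm_factor b v (x - real i))"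
        using y by (simp add: nat_add_distrib)
      also have "\<dots> = norm_factor b v x * (\<Prod>i\<le>nat \<lfloor>y\<rfloor>. norm_factor b v (y - real i))"
        by (subst prod.atMost_Suc_shift) (simp add: y)
      finally have "norm_prod b (x + 1) v = norm_prod b x v * (norm_factor b v x * (\<Prod>i\<le>nat \<lfloor>y\<rfloor>. norm_factor b v (y - real i)))"
        using norm_prod_add_one[of x b v] 3 by simp
      moreover have "norm_prod b x v = norm_prod b y v * (\<Prod>i\<le>nat \<lfloor>y\<rfloor>. norm_factor b v (y - real i))"
        using norm_prod_add_one[of y b v] y by simp
      ultimately show ?thesis using 3 y by (simp add: power2_eq_square)
    qed
  qed
  show ?thesis
  proof (cases "x \<ge> 0")
    case True
    with nonneg half show ?thesis by blast
  next
    case False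
    have "2 * - x \<in> \<int>" using half by (metis Ints_minus mult_minus_right)
    have "\<bar>- x + 1\<bar> = \<bar>x - 1\<bar>" "\<bar>- x - 1\<bar> = \<bar>x + 1\<bar>" by linarith+
    with nonneg[OF \<open>2 * - x \<in> \<int>\<close>] False v show ?thesis by (simp only: norm_factor_minus) (simp add: mult.commute)
  qed
qed

text \<open>The product over the interval \<open>[-p, p - 1]\<close> of second differences is a quotient of first
  differences, and so is the one over \<open>[1 - p, p]\<close>.\<close>
lemma prod_second_difference:
  fixes F g :: "real \<Rightarrow> real"
  assumes F: "\<And>x. F x \<noteq> 0"
    and g: "\<And>j::int. F (c + j + 1) * F (c + j - 1) = (F (c + j))\<^sup>2 * g (c + j)"
  shows "(\<Prod>k<2 * p. g (c + expo k) * g (c - expo k)) =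
    F (c + p + 1) * F (c - p - 1) / (F (c + p - 1) * F (c - p + 1))"
proof (induction p)
  case 0
  then show ?case using F by simp
next
  case (Suc p)
  have g': "g (c + j) = F (c + j + 1) * F (c + j - 1) / (F (c + j))\<^sup>2" for j :: int
    using g[of j] F by (simp add: field_simps)
  have "g (c + p) = F (c + p + 1) * F (c + p - 1) / (F (c + p))\<^sup>2"
    "g (c - p) = F (c - p + 1) * F (c - p - 1) / (F (c - p))\<^sup>2"
    "g (c + p + 1) = F (c + p + 2) * F (c + p) / (F (c + p + 1))\<^sup>2"
    "g (c - p - 1) = F (c - p) * F (c - p - 2) / (F (c - p - 1))\<^sup>2"
    using g'[of "int p"] g'[of "- int p"] g'[of "int p + 1"] g'[of "- int p - 1"]
    by (simp_all add: algebra_simps)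
  note G = this
  have "(\<Prod>k<2 * Suc p. g (c + expo k) * g (c - expo k)) =
    F (c + p + 1) * F (c - p - 1) / (F (c + p - 1) * F (c - p + 1)) *
    (g (c + p) * g (c - p) * (g (c + p + 1) * g (c - p - 1)))"
    unfolding prod_lessThan_double_Suc expo_even expo_odd Suc.IH by (simp add: algebra_simps)
  also have "\<dots> = F (c + p + 2) * F (c - p - 2) / (F (c + p) * F (c - p))"
    unfolding G using F by (simp add: divide_simps) (simp add: power2_eq_square mult_ac)
  finally show ?case by (simp add: algebra_simps)
qed

section \<open>Products over the roots of type B\<close>

definition short_root :: "nat \<Rightarrow> int \<Rightarrow> nat \<Rightarrow> int" where
  "short_root i s = (\<lambda>k. if k = i then s else 0)"

definition long_root :: "nat \<Rightarrow> nat \<Rightarrow> int \<Rightarrow> int \<Rightarrow> nat \<Rightarrow> int" where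
  "long_root i j s u = (\<lambda>k. if k = i then s else if k = j then u else 0)"

lemma roots_B_cases [consumes 1, case_names short long]:
  assumes "a \<in> roots_B N"
  obtains i s where "i < N" "s \<in> {1, -1}" "a = short_root i s"
  | i j s u where "i < j" "j < N" "s \<in> {1, -1}" "u \<in> {1, -1}" "a = long_root i j s u"
  using assms unfolding roots_B_def short_roots_def long_roots_def short_root_def long_root_def by blast

lemma short_root_mem: "i < N \<Longrightarrow> s \<in> {1, -1} \<Longrightarrow> short_root i s \<in> short_roots N"
  unfolding short_roots_def short_root_def by blast

lemma long_root_mem:
  "i < j \<Longrightarrow> j < N \<Longrightarrow> s \<in> {1, -1} \<Longrightarrow> u \<in> {1, -1} \<Longrightarrow> long_root i j s u \<in> long_roots N"
  unfolding long_roots_def long_root_def by blast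

lemma short_roots_image: "short_roots N = (\<lambda>(i, s). short_root i s) ` ({..<N} \<times> {1, -1})"
proof (intro equalityI subsetI)
  fix a assume "a \<in> short_roots N"
  then obtain i s where "i < N" "s \<in> {1, -1}" "a = short_root i s"
    unfolding short_roots_def short_root_def by blast
  then show "a \<in> (\<lambda>(i, s). short_root i s) ` ({..<N} \<times> {1, -1})"
    by (intro image_eqI[where x = "(i, s)"]) simp_all
qed (auto simp del: insert_iff intro!: short_root_mem)

lemma long_roots_image: "long_roots N =
    (\<lambda>((j, i), s, u). long_root i j s u) ` ((SIGMA j:{..<N}. {..<j}) \<times> ({1, -1} \<times> {1, -1}))"
proof (intro equalityI subsetI)
  fix a assume "a \<in> long_roots N"
  then obtain i j s u where "i < j" "j < N" "s \<in> {1, -1}" "u \<in> {1, -1}" "a = long_root i j s u"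
    unfolding long_roots_def long_root_def by blast
  then show "a \<in> (\<lambda>((j, i), s, u). long_root i j s u) ` ((SIGMA j:{..<N}. {..<j}) \<times> ({1, -1} \<times> {1, -1}))"
    by (intro image_eqI[where x = "((j, i), s, u)"]) (simp_all only: mem_Sigma_iff lessThan_iff prod.case simp_thms)
qed (auto simp del: insert_iff intro!: long_root_mem)

lemma support_short_root: "s \<in> {1, -1} \<Longrightarrow> {k. short_root i s k \<noteq> 0} = {i}"
  by (auto simp: short_root_def)

lemma support_long_root: "s \<in> {1, -1} \<Longrightarrow> u \<in> {1, -1} \<Longrightarrow> {k. long_root i j s u k \<noteq> 0} = {i, j}"
  by (auto simp: long_root_def)

lemma inj_short_root: "inj_on (\<lambda>(i, s). short_root i s) ({..<N} \<times> {1, -1})"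
proof -
  have "i = i' \<and> s = s'" if "short_root i s = short_root i' s'" "s \<in> {1, -1}" "s' \<in> {1, -1}" for i s i' s'
  proof -
    have "i = i'" using support_short_root[of s i] support_short_root[of s' i'] that by simp
    then show ?thesis using fun_cong[OF that(1), of i] by (simp add: short_root_def)
  qed
  note inj = this
  show ?thesis
  proof (rule inj_onI)
    let ?A = "{..<N} \<times> {1, -1 :: int}" and ?f = "\<lambda>(i, s). short_root i s"
    fix x y assume xy: "x \<in> ?A" "y \<in> ?A" "?f x = ?f y"
    obtain i s i' s' where e: "x = (i, s)" "y = (i', s')" by (metis surj_pair)
    show "x = y"
      using inj[of i s i' s'] xy unfolding e by (simp only: mem_Sigma_iff prod.case)
  qed
qed

lemma inj_long_root:
  "inj_on (\<lambda>((j, i), s, u). long_root i j s u) ((SIGMA j:{..<N}. {..<j}) \<times> ({1, -1} \<times> {1, -1}))"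
proof -
  have "i = i' \<and> j = j' \<and> s = s' \<and> u = u'"
    if h: "long_root i j s u = long_root i' j' s' u'" "s \<in> {1, -1}" "s' \<in> {1, -1}" "u \<in> {1, -1}" "u' \<in> {1, -1}"
      "i < j" "i' < j'" for i j s u i' j' s' u'
  proof -
    have "{i, j} = {i', j'}"
      using support_long_root[of s u i j] support_long_root[of s' u' i' j'] h(1-5) by metis
    then have "i = i' \<and> j = j'" using h(6,7) by (metis doubleton_eq_iff less_asym)
    then show ?thesis
      using fun_cong[OF h(1), of i] fun_cong[OF h(1), of j] h(6) by (simp add: long_root_def)
  qed
  note inj = this
  show ?thesis
  proof (rule inj_onI)
    let ?A = "(SIGMA j:{..<N}. {..<j}) \<times> ({1, -1} \<times> {1, -1 :: int})"
      and ?f = "\<lambda>((j, i), s, u). long_root i j s u"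
    fix x y assume xy: "x \<in> ?A" "y \<in> ?A" "?f x = ?f y"
    obtain j i s u j' i' s' u' where e: "x = ((j, i), s, u)" "y = ((j', i'), s', u')"
      by (metis surj_pair)
    show "x = y"
      using inj[of i j s u i' j' s' u'] xy unfolding e by (simp only: mem_Sigma_iff lessThan_iff prod.case)
  qed
qed

lemma finite_roots_B: "finite (roots_B N)"
  unfolding roots_B_def short_roots_image long_roots_image
  by (intro finite_UnI finite_imageI finite_SigmaI finite_cartesian_product) simp_all

lemma short_long_disjoint: "short_roots N \<inter> long_roots N = {}"
proof (rule equals0I)
  fix a assume "a \<in> short_roots N \<inter> long_roots N"
  then obtain i s k l t u where "s \<in> {1, -1}" "t \<in> {1, -1}" "u \<in> {1, -1}" "k < l"
    "a = short_root i s" "a = long_root k l t u"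
    unfolding short_roots_def long_roots_def short_root_def long_root_def by blast
  then have "{i} = {k, l}" using support_short_root[of s i] support_long_root[of t u k l] by metis
  then show False using \<open>k < l\<close> by (metis insertI1 insertI2 less_irrefl singletonD)
qed

lemma prod_roots_B:
  fixes f :: "(nat \<Rightarrow> int) \<Rightarrow> 'a :: comm_monoid_mult"
  shows "prod f (roots_B N) = (\<Prod>i<N. f (short_root i 1) * f (short_root i (-1))) *
    (\<Prod>j<N. \<Prod>i<j. f (long_root i j 1 1) * f (long_root i j 1 (-1)) *
       f (long_root i j (-1) 1) * f (long_root i j (-1) (-1)))"
proof -
  have "prod f (roots_B N) = prod f (short_roots N) * prod f (long_roots N)"
    unfolding roots_B_def using finite_roots_B[of N] short_long_disjoint[of N]
    by (intro prod.union_disjoint) (auto simp: roots_B_def)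
  also have "prod f (short_roots N) = (\<Prod>i<N. f (short_root i 1) * f (short_root i (-1)))"
  proof -
    have "prod f (short_roots N) = (\<Prod>(i, s)\<in>{..<N} \<times> {1, -1}. f (short_root i s))"
      unfolding short_roots_image prod.reindex[OF inj_short_root] by (rule prod.cong) auto
    also have "\<dots> = (\<Prod>i<N. \<Prod>s\<in>{1, -1}. f (short_root i s))"
      by (rule prod.cartesian_product[symmetric])
    finally show ?thesis by simp
  qed
  also have "prod f (long_roots N) = (\<Prod>j<N. \<Prod>i<j. f (long_root i j 1 1) * f (long_root i j 1 (-1)) *
       f (long_root i j (-1) 1) * f (long_root i j (-1) (-1)))"
  proof -
    let ?g = "\<lambda>j i. \<Prod>s\<in>{1, -1}. \<Prod>u\<in>{1, -1}. f (long_root i j s u)"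
    have "prod f (long_roots N) =
      (\<Prod>(x, y)\<in>(SIGMA j:{..<N}. {..<j}) \<times> ({1, -1} \<times> {1, -1}). f (long_root (snd x) (fst x) (fst y) (snd y)))"
      unfolding long_roots_image prod.reindex[OF inj_long_root] by (rule prod.cong) auto
    also have "\<dots> = (\<Prod>x\<in>(SIGMA j:{..<N}. {..<j}). \<Prod>y\<in>{1, -1} \<times> {1, -1}.
        f (long_root (snd x) (fst x) (fst y) (snd y)))"
      by (rule prod.cartesian_product[symmetric])
    also have "\<dots> = (\<Prod>x\<in>(SIGMA j:{..<N}. {..<j}). case x of (j, i) \<Rightarrow> ?g j i)"
      by (rule prod.cong) (auto simp: prod.cartesian_product split_def mult.assoc)
    also have "\<dots> = (\<Prod>j<N. \<Prod>i<j. ?g j i)"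
      by (rule prod.Sigma[symmetric]) auto
    finally show ?thesis by (simp add: mult.assoc)
  qed
  finally show ?thesis .
qed

lemma prod_lessThan_add:
  fixes g :: "nat \<Rightarrow> 'a :: comm_monoid_mult"
  shows "(\<Prod>i<n + r. g i) = (\<Prod>i<n. g i) * (\<Prod>k<r. g (n + k))"
  by (induction r) (simp_all add: mult.assoc)

lemma prod_pairs_add:
  fixes h :: "nat \<Rightarrow> nat \<Rightarrow> 'a :: comm_monoid_mult"
  shows "(\<Prod>j<n + r. \<Prod>i<j. h i j) = (\<Prod>j<n. \<Prod>i<j. h i j) *
    (\<Prod>i<n. \<Prod>k<r. h i (n + k)) * (\<Prod>k<r. \<Prod>l<k. h (n + l) (n + k))"
  by (simp add: prod_lessThan_add prod.distrib prod.swap[of _ "{..<r}" "{..<n}"] mult.assoc)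

lemma char_val_short_root: "i < N \<Longrightarrow> char_val N (short_root i s) t = t i powi s"
proof -
  assume "i < N"
  have "char_val N (short_root i s) t = (\<Prod>k\<in>{i}. t k powi short_root i s k)"
    unfolding char_val_def using \<open>i < N\<close>
    by (intro prod.mono_neutral_right) (auto simp: short_root_def)
  then show ?thesis by (simp add: short_root_def)
qed

lemma char_val_long_root: "i < j \<Longrightarrow> j < N \<Longrightarrow> char_val N (long_root i j s u) t = t i powi s * t j powi u"
proof -
  assume "i < j" "j < N"
  have "char_val N (long_root i j s u) t = (\<Prod>k\<in>{i, j}. t k powi long_root i j s u k)"
    unfolding char_val_def using \<open>i < j\<close> \<open>j < N\<close>
    by (intro prod.mono_neutral_right) (auto simp: long_root_def)
  then show ?thesis using \<open>i < j\<close> by (simp add: long_root_def)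
qed

text \<open>A positive system meets each pair \<open>{a, -a}\<close> once, and root length is invariant under negation;
  so the sum is half of the sum over all roots, whichever positive system is taken.\<close>
lemma sum_positive_system:
  fixes x y :: real
  assumes P: "positive_system N P"
  shows "(\<Sum>a\<in>P. if a \<in> long_roots N then x else y) = real N * (real N - 1) * x + real N * y"
proof -
  let ?neg = "\<lambda>a i. - a i :: int"
  let ?f = "\<lambda>a. if a \<in> long_roots N then x else y"
  have neg: "?neg (short_root i s) = short_root i (- s)" "?neg (long_root i j s u) = long_root i j (- s) (- u)" for i j s u
    by (auto simp: short_root_def long_root_def)
  have neg_long: "?neg a \<in> long_roots N" if a: "a \<in> long_roots N" for a
  proof -
    obtain i j s u where "i < j" "j < N" "s \<in> {1, -1}" "u \<in> {1, -1}" "a = long_root i j s u"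
      using a unfolding long_roots_def long_root_def by blast
    then show ?thesis using long_root_mem[of i j N "-s" "-u"] by (auto simp: neg)
  qed
  have neg_R: "?neg a \<in> roots_B N" if "a \<in> roots_B N" for a
    using that
  proof (cases rule: roots_B_cases)
    case (short i s) then show ?thesis using short_root_mem[of i N "-s"] by (auto simp: neg roots_B_def)
  next
    case (long i j s u) then show ?thesis using long_root_mem[of i j N "-s" "-u"] by (auto simp: neg roots_B_def)
  qed
  have neg_long_iff: "?neg a \<in> long_roots N \<longleftrightarrow> a \<in> long_roots N" for a
    using neg_long[of a] neg_long[of "?neg a"] by auto
  have PR: "P \<subseteq> roots_B N" and PN: "\<And>a. a \<in> roots_B N \<Longrightarrow> (a \<in> P) \<noteq> (?neg a \<in> P)"
    using P by (auto simp: positive_system_def)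
  have inj: "inj_on ?neg P"
  proof (rule inj_onI)
    fix a c assume "?neg a = ?neg c"
    then have "- a i = - c i" for i by (rule fun_cong)
    then show "a = c" by (intro ext) simp
  qed
  have "sum ?f (roots_B N) = sum ?f P + sum ?f (?neg ` P)"
  proof (subst sum.union_disjoint[symmetric])
    show "finite P" "finite (?neg ` P)" using finite_subset[OF PR finite_roots_B] by auto
    show "P \<inter> ?neg ` P = {}"
    proof (rule equals0I)
      fix a assume "a \<in> P \<inter> ?neg ` P"
      then obtain c where "c \<in> P" "?neg c \<in> P" by auto
      then show False using PN[of c] PR by blast
    qed
    have "roots_B N \<subseteq> P \<union> ?neg ` P"
    proof
      fix a assume "a \<in> roots_B N"
      then have "a \<in> P \<or> ?neg a \<in> P" using PN[of a] by blast
      then show "a \<in> P \<union> ?neg ` P" using imageI[of "?neg a" P ?neg] by auto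
    qed
    moreover have "?neg ` P \<subseteq> roots_B N" using PR neg_R by (auto dest: subsetD)
    ultimately have "P \<union> ?neg ` P = roots_B N" using PR by (intro equalityI Un_least)
    then show "sum ?f (roots_B N) = sum ?f (P \<union> ?neg ` P)" by simp
  qed
  also have "sum ?f (?neg ` P) = sum ?f P"
    unfolding sum.reindex[OF inj] by (simp add: neg_long_iff o_def)
  finally have "2 * sum ?f P = sum ?f (roots_B N)" by simp
  also have "\<dots> = sum ?f (short_roots N) + sum ?f (long_roots N)"
    unfolding roots_B_def using finite_roots_B[of N] short_long_disjoint[of N]
    by (intro sum.union_disjoint) (auto simp: roots_B_def)
  also have "sum ?f (short_roots N) = real (card (short_roots N)) * y"
    using short_long_disjoint[of N] by (subst sum.cong[where h="\<lambda>_. y"]) auto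
  also have "sum ?f (long_roots N) = real (card (long_roots N)) * x" by simp
  also have "card (short_roots N) = 2 * N"
    unfolding short_roots_image card_image[OF inj_short_root] by (simp add: card_cartesian_product)
  also have "card (long_roots N) = 4 * (\<Sum>j<N. j)"
    unfolding long_roots_image card_image[OF inj_long_root] by (simp add: card_cartesian_product)
  also have "real (4 * (\<Sum>j<N. j)) = 2 * real N * (real N - 1)"
    by (induction N) (simp_all add: algebra_simps)
  finally show ?thesis by (simp add: algebra_simps)
qed

section \<open>Coordinate subtori\<close>

lemma torus_simps [simp]:
  "carrier (torus N) = {t. (\<forall>i<N. t i \<noteq> 0) \<and> (\<forall>i\<ge>N. t i = 1)}"
  "mult (torus N) s t = (\<lambda>i. s i * t i)" "one (torus N) = (\<lambda>i. 1)"
  by (simp_all add: torus_def)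

lemma comm_group_torus: "comm_group (torus N)"
proof (rule comm_groupI)
  fix x assume x: "x \<in> carrier (torus N)"
  have "x i \<noteq> 0" for i using x by (cases "i < N") auto
  then show "\<exists>y\<in>carrier (torus N). y \<otimes>\<^bsub>torus N\<^esub> x = \<one>\<^bsub>torus N\<^esub>"
    using x by (intro bexI[where x = "\<lambda>i. inverse (x i)"]) (auto simp: fun_eq_iff)
qed (auto simp: fun_eq_iff mult_ac)

lemma inv_torus: "x \<in> carrier (torus N) \<Longrightarrow> inv\<^bsub>torus N\<^esub> x = (\<lambda>i. inverse (x i))"
proof -
  interpret comm_group "torus N" by (rule comm_group_torus)
  assume x: "x \<in> carrier (torus N)"
  have "x i \<noteq> 0" for i using x by (cases "i < N") auto
  then show ?thesis using x by (intro inv_equality) (auto simp: fun_eq_iff)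
qed

definition coord_subtorus :: "nat \<Rightarrow> nat \<Rightarrow> (nat \<Rightarrow> complex) set" where
  "coord_subtorus l k =
     {t. (\<forall>i. l \<le> i \<and> i < l + k \<longrightarrow> t i \<noteq> 0) \<and> (\<forall>i. \<not> (l \<le> i \<and> i < l + k) \<longrightarrow> t i = 1)}"

lemma carrier_torus_coord: "carrier (torus n) = coord_subtorus 0 n"
  by (simp add: coord_subtorus_def not_less)

lemma subtorus_coord: assumes "l + k \<le> N" shows "subtorus N k (coord_subtorus l k)"
proof -
  define y :: "nat \<Rightarrow> nat \<Rightarrow> int" where "y = (\<lambda>i j. if j = l + i then 1 else 0)"
  have val: "(\<Prod>i<k. s i powi y i j) = (if l \<le> j \<and> j < l + k then s (j - l) else 1)" for s :: "nat \<Rightarrow> complex" and j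
  proof -
    have "(\<Prod>i<k. s i powi y i j) = (\<Prod>i<k. if i = j - l then (if l \<le> j then s i else 1) else 1)"
      by (rule prod.cong) (auto simp: y_def)
    also have "\<dots> = (if l \<le> j \<and> j < l + k then s (j - l) else 1)"
      by (subst prod.delta) auto
    finally show ?thesis .
  qed
  have "inj_on (\<lambda>s j. if l \<le> j \<and> j < l + k then s (j - l) else 1) (carrier (torus k))"
  proof (rule inj_onI, rule ext)
    fix s t :: "nat \<Rightarrow> complex" and i
    assume st: "s \<in> carrier (torus k)" "t \<in> carrier (torus k)"
      and eq: "(\<lambda>j. if l \<le> j \<and> j < l + k then s (j - l) else 1) = (\<lambda>j. if l \<le> j \<and> j < l + k then t (j - l) else 1)"
    show "s i = t i"
      using st fun_cong[OF eq, of "l + i"] by (cases "i < k") auto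
  qed
  moreover have "coord_subtorus l k = (\<lambda>s j. if l \<le> j \<and> j < l + k then s (j - l) else 1) ` carrier (torus k)"
  proof (intro equalityI subsetI)
    fix t assume "t \<in> coord_subtorus l k"
    then have t: "\<And>i. l \<le> i \<and> i < l + k \<Longrightarrow> t i \<noteq> 0"
      and t': "\<And>i. \<not> (l \<le> i \<and> i < l + k) \<Longrightarrow> t i = 1"
      unfolding coord_subtorus_def by blast+
    let ?s = "\<lambda>i. if i < k then t (l + i) else 1"
    have "t j = (if l \<le> j \<and> j < l + k then ?s (j - l) else 1)" for j
      using t'[of j] by auto
    moreover have "?s \<in> carrier (torus k)" using t by simp
    ultimately show "t \<in> (\<lambda>s j. if l \<le> j \<and> j < l + k then s (j - l) else 1) ` carrier (torus k)"
      by (intro image_eqI[where x = ?s] ext)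
  next
    fix t assume "t \<in> (\<lambda>s j. if l \<le> j \<and> j < l + k then s (j - l) else 1) ` carrier (torus k)"
    then obtain s where "s \<in> carrier (torus k)" "t = (\<lambda>j. if l \<le> j \<and> j < l + k then s (j - l) else 1)"
      by blast
    then show "t \<in> coord_subtorus l k" by (auto simp: coord_subtorus_def)
  qed
  moreover have "\<forall>i<k. y i \<in> lattice_Z N" using assms by (auto simp: y_def lattice_Z_def)
  ultimately show ?thesis unfolding subtorus_def by (intro exI[of _ y]) (simp only: val)
qed

lemma cochar_lattice_coord:
  assumes "l + k \<le> N"
  shows "cochar_lattice N (coord_subtorus l k) = {y. \<forall>i. \<not> (l \<le> i \<and> i < l + k) \<longrightarrow> y i = 0}"
proof (intro equalityI subsetI CollectI allI impI)
  fix y i assume y: "y \<in> cochar_lattice N (coord_subtorus l k)" and i: "\<not> (l \<le> i \<and> i < l + k)"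
  \<comment> \<open>\<open>2\<close> is not a root of unity\<close>
  have "cochar_val y 2 \<in> coord_subtorus l k" using y by (auto simp: cochar_lattice_def)
  then have "(2 :: complex) powi y i = 1"
    using i unfolding coord_subtorus_def cochar_val_def by (auto split: if_splits)
  then have "(2 :: real) powi y i = 1" by (metis norm_numeral norm_one norm_power_int)
  then show "y i = 0" by (simp add: powi_eq_one_real)
next
  fix y :: "nat \<Rightarrow> int" assume "y \<in> {y. \<forall>i. \<not> (l \<le> i \<and> i < l + k) \<longrightarrow> y i = 0}"
  then show "y \<in> cochar_lattice N (coord_subtorus l k)"
    using assms by (auto simp: cochar_lattice_def lattice_Z_def coord_subtorus_def cochar_val_def)
qed

lemma subtorus_one: "subtorus N k S \<Longrightarrow> (\<lambda>i. 1) \<in> S"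
proof -
  assume "subtorus N k S"
  then obtain y where "S = (\<lambda>s j. \<Prod>i<k. s i powi y i j) ` carrier (torus k)" by (auto simp: subtorus_def)
  then show ?thesis by (auto intro!: image_eqI[where x = "\<lambda>_. 1"])
qed

lemma subtorus_mult: assumes "subtorus N k S" "a \<in> S" "c \<in> S" shows "(\<lambda>i. a i * c i) \<in> S"
proof -
  obtain y where S: "S = (\<lambda>s j. \<Prod>i<k. s i powi y i j) ` carrier (torus k)" using assms by (auto simp: subtorus_def)
  then obtain s t where "s \<in> carrier (torus k)" "t \<in> carrier (torus k)"
    "a = (\<lambda>j. \<Prod>i<k. s i powi y i j)" "c = (\<lambda>j. \<Prod>i<k. t i powi y i j)" using assms by blast
  then show ?thesis unfolding S
    by (intro image_eqI[where x = "\<lambda>i. s i * t i"]) (auto simp: power_int_mult_distrib prod.distrib)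
qed

text \<open>A subtorus is generated by the images of its cocharacters, so it is determined by its cocharacter
  lattice. For a coordinate subtorus the generators are the standard basis vectors.\<close>
lemma subtorus_eq_coord:
  assumes S: "subtorus N k' S" and lk: "l + k \<le> N"
    and eq: "cochar_lattice N S = cochar_lattice N (coord_subtorus l k)"
  shows "S = coord_subtorus l k"
proof (intro equalityI subsetI)
  fix x assume "x \<in> S"
  obtain y where y: "\<forall>i<k'. y i \<in> lattice_Z N" and S': "S = (\<lambda>s j. \<Prod>i<k'. s i powi y i j) ` carrier (torus k')"
    using S by (auto simp: subtorus_def)
  have "y i \<in> cochar_lattice N S" if "i < k'" for i
  proof -
    have "cochar_val (y i) z \<in> S" if z: "z \<noteq> 0" for z
    proof -
      have "cochar_val (y i) z = (\<lambda>j. \<Prod>i'<k'. (if i' = i then z else 1) powi y i' j)"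
      proof (rule ext)
        fix j
        have "(\<Prod>i'<k'. (if i' = i then z else 1) powi y i' j) = (\<Prod>i'<k'. if i' = i then z powi y i' j else 1)"
          by (rule prod.cong) auto
        also have "\<dots> = z powi y i j" using \<open>i < k'\<close> by (subst prod.delta) auto
        finally show "cochar_val (y i) z j = (\<Prod>i'<k'. (if i' = i then z else 1) powi y i' j)"
          by (simp add: cochar_val_def)
      qed
      then show ?thesis unfolding S' using z \<open>i < k'\<close>
        by (intro image_eqI[where x = "\<lambda>i'. if i' = i then z else 1"]) auto
    qed
    then show ?thesis using y that by (auto simp: cochar_lattice_def)
  qed
  then have y0: "y i j = 0" if "i < k'" "\<not> (l \<le> j \<and> j < l + k)" for i j
    using that unfolding eq cochar_lattice_coord[OF lk] by blast
  from \<open>x \<in> S\<close> obtain s where "s \<in> carrier (torus k')" "x = (\<lambda>j. \<Prod>i<k'. s i powi y i j)" unfolding S' by blast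
  then show "x \<in> coord_subtorus l k"
    unfolding coord_subtorus_def by (auto simp: y0 intro!: prod.neutral)
next
  fix t assume t: "t \<in> coord_subtorus l k"
  have "(\<lambda>j. if l \<le> j \<and> j < l + r then t j else 1) \<in> S" if "r \<le> k" for r
    using that
  proof (induction r)
    case 0
    have "(\<lambda>j. if l \<le> j \<and> j < l + 0 then t j else 1) = (\<lambda>_. 1)" by (auto simp: fun_eq_iff)
    then show ?case using subtorus_one[OF S] by simp
  next
    case (Suc r)
    let ?e = "\<lambda>j. if j = l + r then 1 else 0 :: int"
    have "?e \<in> cochar_lattice N S" unfolding eq cochar_lattice_coord[OF lk] using Suc.prems by auto
    moreover have "t (l + r) \<noteq> 0" using t Suc.prems by (auto simp: coord_subtorus_def)
    ultimately have "cochar_val ?e (t (l + r)) \<in> S" by (simp add: cochar_lattice_def)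
    from subtorus_mult[OF S Suc.IH this] Suc.prems
    have "(\<lambda>j. (if l \<le> j \<and> j < l + r then t j else 1) * cochar_val ?e (t (l + r)) j) \<in> S" by simp
    also have "(\<lambda>j. (if l \<le> j \<and> j < l + r then t j else 1) * cochar_val ?e (t (l + r)) j) =
      (\<lambda>j. if l \<le> j \<and> j < l + Suc r then t j else 1)"
      by (auto simp: cochar_val_def fun_eq_iff)
    finally show ?case .
  qed
  from this[of k] have "(\<lambda>j. if l \<le> j \<and> j < l + k then t j else 1) \<in> S" by simp
  also have "(\<lambda>j. if l \<le> j \<and> j < l + k then t j else 1) = t"
    using t by (force simp: coord_subtorus_def fun_eq_iff)
  finally show "t \<in> S" .
qed

text \<open>The coroots of the short roots \<open>t\<^sub>i\<close> with \<open>n \<le> i\<close> are twice the standard basis vectors, so they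
  span all cocharacters supported on these coordinates.\<close>
lemma coroot_span_coord:
  fixes n r :: nat
  assumes A: "A = {a \<in> roots_B (n + r). \<forall>i<n. a i = 0}"
  shows "coroot_span (n + r) A = {y. \<forall>i. \<not> (n \<le> i \<and> i < n + r) \<longrightarrow> y i = 0}"
proof (intro equalityI subsetI CollectI allI impI)
  fix y i assume y: "y \<in> coroot_span (n + r) A" and i: "\<not> (n \<le> i \<and> i < n + r)"
  show "y i = 0"
  proof (cases "i < n")
    case True
    obtain c where "of_int (y i) = (\<Sum>a\<in>A. c a * of_int (coroot (n + r) a i) :: rat)"
      using y by (auto simp: coroot_span_def)
    also have "\<dots> = 0" using True by (intro sum.neutral) (auto simp: A coroot_def)
    finally show ?thesis by simp
  qed (use y i in \<open>auto simp: coroot_span_def lattice_Z_def\<close>)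
next
  fix y :: "nat \<Rightarrow> int" assume "y \<in> {y. \<forall>i. \<not> (n \<le> i \<and> i < n + r) \<longrightarrow> y i = 0}"
  then have y0: "\<And>i. \<not> (n \<le> i \<and> i < n + r) \<Longrightarrow> y i = 0" by blast
  \<comment> \<open>a sum instead of a case distinction, so that exchanging the two summations evaluates it\<close>
  define c :: "(nat \<Rightarrow> int) \<Rightarrow> rat" where
    "c = (\<lambda>a. \<Sum>i\<in>{n..<n + r}. if a = short_root i 1 then of_int (y i) / 2 else 0)"
  have fin: "finite A" using finite_roots_B[of "n + r"] by (simp add: A)
  have mem: "short_root i 1 \<in> A" if "i \<in> {n..<n + r}" for i
    using that short_root_mem[of i "n + r" 1] by (auto simp: A roots_B_def short_root_def)
  have cor: "coroot (n + r) (short_root i 1) j = (if j = i then 2 else 0)" if "i \<in> {n..<n + r}" for i j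
  proof -
    have "(\<Sum>j<n + r. (short_root i 1 j)\<^sup>2) = (\<Sum>j<n + r. if j = i then 1 else 0)"
      by (rule sum.cong) (auto simp: short_root_def)
    also have "\<dots> = 1" using that by simp
    finally show ?thesis by (simp add: coroot_def short_root_def)
  qed
  have "of_int (y j) = (\<Sum>a\<in>A. c a * of_int (coroot (n + r) a j))" for j
  proof -
    have "(\<Sum>a\<in>A. c a * of_int (coroot (n + r) a j)) =
      (\<Sum>a\<in>A. \<Sum>i\<in>{n..<n + r}. if a = short_root i 1 then of_int (y i) / 2 * of_int (coroot (n + r) a j) else 0)"
      unfolding c_def sum_distrib_right by (intro sum.cong) auto
    also have "\<dots> = (\<Sum>i\<in>{n..<n + r}. \<Sum>a\<in>A. if a = short_root i 1 then of_int (y i) / 2 * of_int (coroot (n + r) a j) else 0)"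
      by (rule sum.swap)
    also have "\<dots> = (\<Sum>i\<in>{n..<n + r}. if i = j then of_int (y i) else 0)"
      using fin mem by (intro sum.cong) (auto simp: cor)
    also have "\<dots> = of_int (y j)" using y0[of j] by auto
    finally show ?thesis by simp
  qed
  then show "y \<in> coroot_span (n + r) A"
    using y0 unfolding coroot_span_def lattice_Z_def by auto
qed

lemma T_sub_coord:
  assumes "constant_roots (n + r) L = {a \<in> roots_B (n + r). \<forall>i<n. a i = 0}"
  shows "T_sub (n + r) L = coord_subtorus n r"
  unfolding T_sub_def
proof (rule the_equality)
  have lat: "coroot_span (n + r) (constant_roots (n + r) L) = cochar_lattice (n + r) (coord_subtorus n r)"
    unfolding coroot_span_coord[OF assms] by (simp add: cochar_lattice_coord)
  show "(\<exists>k. subtorus (n + r) k (coord_subtorus n r)) \<and>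
    cochar_lattice (n + r) (coord_subtorus n r) = coroot_span (n + r) (constant_roots (n + r) L)"
    unfolding lat using subtorus_coord[of n r "n + r"] by auto
  fix S assume "(\<exists>k. subtorus (n + r) k S) \<and>
    cochar_lattice (n + r) S = coroot_span (n + r) (constant_roots (n + r) L)"
  then show "S = coord_subtorus n r" unfolding lat using subtorus_eq_coord by blast
qed

section \<open>The embedding along a strip of powers of q\<close>

definition strip_embed :: "nat \<Rightarrow> nat \<Rightarrow> real \<Rightarrow> (nat \<Rightarrow> complex) \<Rightarrow> nat \<Rightarrow> complex" where
  "strip_embed n p q t = (\<lambda>i. if i < n then t i
     else if i < n + 2 * p then of_real (q powi expo (i - n)) else 1)"

lemma strip_embed_head [simp]: "i < n \<Longrightarrow> strip_embed n p q t i = t i"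
  and strip_embed_tail [simp]: "k < 2 * p \<Longrightarrow> strip_embed n p q t (n + k) = of_real (q powi expo k)"
  by (simp_all add: strip_embed_def)

lemma strip_embed_nonzero:
  assumes "q > 0" "t \<in> carrier (torus n)" shows "strip_embed n p q t i \<noteq> 0"
  using assms by (simp add: strip_embed_def)

lemma strip_embed_mem:
  assumes "q > 0" "t \<in> carrier (torus n)"
  shows "strip_embed n p q t \<in> carrier (torus (n + 2 * p))"
  using strip_embed_nonzero[OF assms] by (simp add: strip_embed_def)

lemma strip_embed_hom:
  fixes n p :: nat and q :: real
  assumes q: "q > 0"
  defines "\<phi> \<equiv> strip_embed n p q"
  shows "\<phi> \<in> hom (torus n) (based_coset (torus (n + 2 * p)) (\<phi> ` carrier (torus n)) (\<phi> \<one>\<^bsub>torus n\<^esub>))"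
proof (rule homI)
  fix s t assume st: "s \<in> carrier (torus n)" "t \<in> carrier (torus n)"
  have one: "\<phi> \<one>\<^bsub>torus n\<^esub> \<in> carrier (torus (n + 2 * p))"
    unfolding \<phi>_def by (rule strip_embed_mem) (use q in auto)
  show "\<phi> (s \<otimes>\<^bsub>torus n\<^esub> t) = \<phi> s \<otimes>\<^bsub>based_coset (torus (n + 2 * p)) (\<phi> ` carrier (torus n)) (\<phi> \<one>\<^bsub>torus n\<^esub>)\<^esub> \<phi> t"
    unfolding based_coset_def using inv_torus[OF one] q
    by (simp add: fun_eq_iff \<phi>_def strip_embed_def)
qed (simp_all add: based_coset_def)

lemma strip_embed_coset:
  assumes q: "q > 0"
  shows "subtorus_coset (n + 2 * p) n (strip_embed n p q ` carrier (torus n))"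
proof -
  have one: "strip_embed n p q (\<lambda>_. 1) \<in> carrier (torus (n + 2 * p))"
    by (rule strip_embed_mem) (use q in auto)
  have "strip_embed n p q t i = strip_embed n p q (\<lambda>_. 1) i * t i" if "t \<in> carrier (torus n)" for t i
    using that by (auto simp: strip_embed_def)
  then have "strip_embed n p q t = (\<lambda>i. strip_embed n p q (\<lambda>_. 1) i * t i)" if "t \<in> carrier (torus n)" for t
    using that by blast
  then have "strip_embed n p q ` carrier (torus n) = strip_embed n p q (\<lambda>_. 1) <#\<^bsub>torus (n + 2 * p)\<^esub> carrier (torus n)"
    unfolding l_coset_def by (auto simp del: torus_simps(1) simp: image_iff)
  then show ?thesis
    unfolding subtorus_coset_def using subtorus_coord[of 0 n "n + 2 * p"] one
    by (metis carrier_torus_coord add_0 le_add1)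
qed

lemma regular_functions_sum:
  assumes "finite A" "\<And>x. x \<in> A \<Longrightarrow> f x \<in> regular_functions N"
  shows "(\<lambda>t. \<Sum>x\<in>A. f x t) \<in> regular_functions N"
proof -
  have add: "(\<lambda>t. f t + g t) \<in> regular_functions N" if f: "f \<in> regular_functions N" and g: "g \<in> regular_functions N" for f g
  proof -
    obtain A c where A: "finite A" "A \<subseteq> lattice_Z N" "\<forall>t\<in>carrier (torus N). f t = (\<Sum>x\<in>A. c x * char_val N x t)"
      using f unfolding regular_functions_def by blast
    obtain B d where B: "finite B" "B \<subseteq> lattice_Z N" "\<forall>t\<in>carrier (torus N). g t = (\<Sum>x\<in>B. d x * char_val N x t)"
      using g unfolding regular_functions_def by blast
    have "f t + g t = (\<Sum>x\<in>A \<union> B. ((if x \<in> A then c x else 0) + (if x \<in> B then d x else 0)) * char_val N x t)"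
      if "t \<in> carrier (torus N)" for t
    proof -
      have "(\<Sum>x\<in>A. c x * char_val N x t) = (\<Sum>x\<in>A \<union> B. (if x \<in> A then c x else 0) * char_val N x t)"
        using A(1) B(1) by (intro sum.mono_neutral_cong_left) auto
      moreover have "(\<Sum>x\<in>B. d x * char_val N x t) = (\<Sum>x\<in>A \<union> B. (if x \<in> B then d x else 0) * char_val N x t)"
        using A(1) B(1) by (intro sum.mono_neutral_cong_left) auto
      ultimately show ?thesis using A(3) B(3) that by (simp only: distrib_right sum.distrib)
    qed
    then show ?thesis unfolding regular_functions_def
      using A(1,2) B(1,2)
      by (intro CollectI exI[of _ "A \<union> B"] exI[of _ "\<lambda>x. (if x \<in> A then c x else 0) + (if x \<in> B then d x else 0)"]) simp
  qed
  have zero: "(\<lambda>t. 0) \<in> regular_functions N"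
    unfolding regular_functions_def by (intro CollectI exI[of _ "{}"]) simp
  show ?thesis using assms by (induction A rule: finite_induct) (auto intro: zero add)
qed

lemma regular_functions_monomial: "x \<in> lattice_Z N \<Longrightarrow> (\<lambda>t. c * char_val N x t) \<in> regular_functions N"
  unfolding regular_functions_def by (intro CollectI exI[of _ "{x}"] exI[of _ "\<lambda>_. c"]) auto

lemma regular_functions_cong:
  "f \<in> regular_functions N \<Longrightarrow> (\<And>t. t \<in> carrier (torus N) \<Longrightarrow> g t = f t) \<Longrightarrow> g \<in> regular_functions N"
  unfolding regular_functions_def by simp

lemma char_val_strip_embed:
  "char_val (n + 2 * p) x (strip_embed n p q t) =
   (\<Prod>k<2 * p. of_real (q powi expo k) powi x (n + k)) * char_val n (\<lambda>i. if i < n then x i else 0) t"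
  by (simp add: char_val_def prod_lessThan_add mult.commute)

text \<open>The characters of the first \<open>n\<close> coordinates extend to the target, so restriction of regular functions
  is surjective and the coordinate ring of the source is generated by \<open>1\<close>.\<close>
lemma strip_embed_finite:
  assumes q: "q > 0"
  shows "finite_morphism n (n + 2 * p) (strip_embed n p q)"
proof -
  let ?N = "n + 2 * p" and ?\<phi> = "strip_embed n p q"
  have "f \<circ> ?\<phi> \<in> regular_functions n" if f: "f \<in> regular_functions ?N" for f
  proof -
    obtain A c where A: "finite A" "A \<subseteq> lattice_Z ?N"
      "\<forall>t\<in>carrier (torus ?N). f t = (\<Sum>x\<in>A. c x * char_val ?N x t)"
      using f unfolding regular_functions_def by blast
    have "(\<lambda>t. \<Sum>x\<in>A. (c x * (\<Prod>k<2 * p. of_real (q powi expo k) powi x (n + k))) *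
        char_val n (\<lambda>i. if i < n then x i else 0) t) \<in> regular_functions n"
      using A(1) by (intro regular_functions_sum regular_functions_monomial) (auto simp: lattice_Z_def)
    then show ?thesis
    proof (rule regular_functions_cong)
      fix t assume "t \<in> carrier (torus n)"
      then have "?\<phi> t \<in> carrier (torus ?N)" by (rule strip_embed_mem[OF q])
      then have "(f \<circ> ?\<phi>) t = (\<Sum>x\<in>A. c x * char_val ?N x (?\<phi> t))" using A(3) by simp
      then show "(f \<circ> ?\<phi>) t = (\<Sum>x\<in>A. (c x * (\<Prod>k<2 * p. of_real (q powi expo k) powi x (n + k))) *
        char_val n (\<lambda>i. if i < n then x i else 0) t)"
        by (simp only: char_val_strip_embed mult.assoc)
    qed
  qed
  then have "torus_morphism n ?N ?\<phi>"
    unfolding torus_morphism_def using strip_embed_mem[OF q] by blast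
  moreover have "\<exists>a. (\<forall>g\<in>{\<lambda>t. 1}. a g \<in> regular_functions ?N) \<and>
      (\<forall>t\<in>carrier (torus n). f t = (\<Sum>g\<in>{\<lambda>t. 1}. a g (?\<phi> t) * g t))"
    if f: "f \<in> regular_functions n" for f
  proof -
    obtain A c where A: "finite A" "A \<subseteq> lattice_Z n"
      "\<forall>t\<in>carrier (torus n). f t = (\<Sum>x\<in>A. c x * char_val n x t)"
      using f unfolding regular_functions_def by blast
    have "char_val ?N x (?\<phi> t) = char_val n x t" if "x \<in> A" for x t
    proof -
      have "x i = 0" if "i \<ge> n" for i using A(2) \<open>x \<in> A\<close> that by (auto simp: lattice_Z_def)
      then show ?thesis by (simp add: char_val_strip_embed) (simp add: char_val_def)
    qed
    then have "\<forall>t\<in>carrier (torus n). f t = (\<Sum>x\<in>A. c x * char_val ?N x (?\<phi> t))"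
      using A(3) by (simp cong: sum.cong)
    moreover have "(\<lambda>t. \<Sum>x\<in>A. c x * char_val ?N x t) \<in> regular_functions ?N"
      using A(1,2) by (intro regular_functions_sum regular_functions_monomial) (auto simp: lattice_Z_def)
    ultimately show ?thesis
      by (intro exI[of _ "\<lambda>_ t. \<Sum>x\<in>A. c x * char_val ?N x t"]) simp
  qed
  moreover have "(\<lambda>t. 1) \<in> regular_functions n"
    using regular_functions_monomial[of "\<lambda>_. 0" n 1] by (simp add: lattice_Z_def char_val_def)
  ultimately show ?thesis
    unfolding finite_morphism_def by (intro conjI exI[of _ "{\<lambda>t. 1}"]) simp_all
qed

section \<open>Roots on the image\<close>

text \<open>The angles lie in \<open>(0, 1]\<close> and are distinct, so sums and differences of two of them, and each one
  alone, are nonzero of absolute value less than \<open>2 < \<pi>\<close>. Hence all roots take non-real values at this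
  point. The parameters and the tail coordinates are real; so no denominator factor of such a root
  vanishes here, and a root involving a head coordinate is not constant on the image, being real at the
  image of the identity.\<close>

definition generic_point :: "nat \<Rightarrow> nat \<Rightarrow> complex" where
  "generic_point n = (\<lambda>i. if i < n then cis (real (Suc i) / real (Suc n)) else 1)"

lemma generic_point_mem: "generic_point n \<in> carrier (torus n)"
  by (simp add: generic_point_def)

lemma cis_powi_sign: "s \<in> {1, -1} \<Longrightarrow> cis x powi s = cis (of_int s * x)"
  by (auto simp: power_int_minus)

lemma sin_nonzero: fixes x :: real assumes "x \<noteq> 0" "\<bar>x\<bar> < 2" shows "sin x \<noteq> 0"
proof -
  have "sin \<bar>x\<bar> > 0" using assms by (intro sin_gt_zero_02) auto
  then show ?thesis by (auto simp: abs_if split: if_splits)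
qed

lemma char_val_generic_short:
  assumes "i < n" "s \<in> {1, -1}"
  shows "Im (generic_point n i powi s) \<noteq> 0"
proof -
  define x where "x = real (Suc i) / real (Suc n)"
  have "0 < x" "x \<le> 1" using assms by (auto simp: x_def)
  then have "sin (of_int s * x) \<noteq> 0" using assms by (intro sin_nonzero) auto
  moreover have "generic_point n i powi s = cis (of_int s * x)"
    using assms cis_powi_sign[of s x] unfolding generic_point_def x_def by simp
  ultimately show ?thesis by (simp only: cis.sel not_False_eq_True)
qed

lemma char_val_generic_long:
  assumes "i < j" "j < n" "s \<in> {1, -1}" "u \<in> {1, -1}"
  shows "Im (generic_point n i powi s * generic_point n j powi u) \<noteq> 0"
proof -
  define x y where "x = real (Suc i) / real (Suc n)" and "y = real (Suc j) / real (Suc n)"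
  have xy: "0 < x" "x < y" "y \<le> 1" using assms by (auto simp: x_def y_def divide_strict_right_mono)
  have "sin (of_int s * x + of_int u * y) \<noteq> 0" using assms(3,4) xy by (intro sin_nonzero) auto
  moreover have "generic_point n i powi s = cis (of_int s * x)" "generic_point n j powi u = cis (of_int u * y)"
    using assms cis_powi_sign[of s x] cis_powi_sign[of u y] unfolding generic_point_def x_def y_def by simp_all
  ultimately show ?thesis by (simp only: cis_mult cis.sel not_False_eq_True)
qed

lemma char_val_head:
  assumes "\<forall>k<2 * p. a (n + k) = 0"
  shows "char_val (n + 2 * p) a (strip_embed n p q t) = char_val n a t"
  using assms by (simp add: char_val_strip_embed) (simp add: char_val_def)

lemma tail_short_value:
  assumes "k < 2 * p" "q > 0" "s \<in> {1, -1}"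
  shows "char_val (n + 2 * p) (short_root (n + k) s) (strip_embed n p q t) = of_real (q powi (s * expo k))"
  using assms by (auto simp: char_val_short_root of_real_power_int power_int_minus)

lemma tail_long_value:
  assumes "l < k" "k < 2 * p" "q > 0" "s \<in> {1, -1}" "u \<in> {1, -1}"
  shows "char_val (n + 2 * p) (long_root (n + l) (n + k) s u) (strip_embed n p q t) =
    of_real (q powi (s * expo l + u * expo k))"
proof -
  have "of_real (q powi e) powi s = (of_real (q powi (s * e)) :: complex)" if "s \<in> {1, -1}" for e s
    using that by (auto simp: of_real_power_int power_int_minus)
  then show ?thesis
    using assms by (simp add: char_val_long_root power_int_add)
qed

lemma mixed_value:
  assumes "i < n" "k < 2 * p"  "q > 0" "s \<in> {1, -1}" "u \<in> {1, -1}"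
  shows "char_val (n + 2 * p) (long_root i (n + k) s u) (strip_embed n p q t) =
    t i powi s * of_real (q powi (u * expo k))"
proof -
  have "of_real (q powi e) powi s = (of_real (q powi (s * e)) :: complex)" if "s \<in> {1, -1}" for e s
    using that by (auto simp: of_real_power_int power_int_minus)
  then show ?thesis using assms by (simp add: char_val_long_root)
qed

lemma tail_root_value:
  assumes a: "a \<in> roots_B (n + 2 * p)" "\<forall>i<n. a i = 0" and q: "q > 0"
  obtains c where "\<And>t. char_val (n + 2 * p) a (strip_embed n p q t) = of_real (q powi c)"
  using a(1)
proof (cases rule: roots_B_cases)
  case (short i s)
  have "\<not> i < n" using a(2) short by (auto simp: short_root_def)
  then obtain k where "i = n + k" "k < 2 * p" using short by (metis le_Suc_ex not_less nat_add_left_cancel_less)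
  then show thesis using that tail_short_value[of k p q s n] short q by metis
next
  case (long i j s u)
  have "\<not> i < n" using a(2) long by (auto simp: long_root_def)
  then obtain l where l: "i = n + l" by (metis le_Suc_ex not_less)
  then obtain k where k: "j = n + k" using long by (metis le_Suc_ex less_imp_le add.assoc)
  then show thesis using that tail_long_value[of l k p q s u n] long l q by (metis nat_add_left_cancel_less)
qed

lemma head_root_value:
  assumes a: "a \<in> roots_B (n + 2 * p)" "\<not> (\<forall>i<n. a i = 0)" and q: "q > 0"
  shows "Im (char_val (n + 2 * p) a (strip_embed n p q (generic_point n))) \<noteq> 0"
  using a(1)
proof (cases rule: roots_B_cases)
  case (short i s)
  then have "i < n" using a(2) by (auto simp: short_root_def split: if_splits)
  then show ?thesis using short char_val_generic_short[of i n s] by (simp add: char_val_short_root)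
next
  case (long i j s u)
  then have i: "i < n" using a(2) by (auto simp: long_root_def split: if_splits)
  show ?thesis
  proof (cases "j < n")
    case True
    then show ?thesis using long i char_val_generic_long[of i j n s u] by (simp add: char_val_long_root)
  next
    case False
    then obtain k where k: "j = n + k" "k < 2 * p" using long by (metis le_Suc_ex not_less nat_add_left_cancel_less)
    have "q powi (u * expo k) \<noteq> 0" using q by simp
    then show ?thesis
      using long i k char_val_generic_short[of i n s] mixed_value[of i n k p q s u] q by (simp del: of_real_power_int)
  qed
qed

lemma value_at_one_real:
  assumes q: "q > 0"
  shows "Im (char_val (n + 2 * p) a (strip_embed n p q (\<lambda>_. 1))) = 0"
proof -
  have "strip_embed n p q (\<lambda>_. 1) = (\<lambda>i. of_real (if i < n then 1 else if i < n + 2 * p then q powi expo (i - n) else 1))"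
    by (simp add: strip_embed_def fun_eq_iff)
  then have "char_val (n + 2 * p) a (strip_embed n p q (\<lambda>_. 1)) \<in> \<real>"
    unfolding char_val_def by (simp only: of_real_power_int[symmetric] of_real_prod[symmetric] Reals_of_real)
  then show ?thesis by (simp add: complex_is_Real_iff)
qed

lemma constant_roots_strip:
  assumes q: "q > 0"
  shows "constant_roots (n + 2 * p) (strip_embed n p q ` carrier (torus n)) =
    {a \<in> roots_B (n + 2 * p). \<forall>i<n. a i = 0}"
proof (intro equalityI subsetI)
  fix a assume a: "a \<in> constant_roots (n + 2 * p) (strip_embed n p q ` carrier (torus n))"
  then obtain c where "\<And>t. t \<in> carrier (torus n) \<Longrightarrow> char_val (n + 2 * p) a (strip_embed n p q t) = c"
    and R: "a \<in> roots_B (n + 2 * p)"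
    unfolding constant_roots_def by blast
  from this(1)[OF generic_point_mem] this(1)[of "\<lambda>_. 1"]
  have "Im (char_val (n + 2 * p) a (strip_embed n p q (generic_point n))) = 0"
    using value_at_one_real[OF q, of n p a] by simp
  then show "a \<in> {a \<in> roots_B (n + 2 * p). \<forall>i<n. a i = 0}" using head_root_value[OF R _ q] R by blast
next
  fix a assume "a \<in> {a \<in> roots_B (n + 2 * p). \<forall>i<n. a i = 0}"
  then have a: "a \<in> roots_B (n + 2 * p)" "\<forall>i<n. a i = 0" by simp_all
  obtain c where "\<And>t. char_val (n + 2 * p) a (strip_embed n p q t) = of_real (q powi c)"
    by (rule tail_root_value[OF a q]) blast
  then show "a \<in> constant_roots (n + 2 * p) (strip_embed n p q ` carrier (torus n))"
    unfolding constant_roots_def using a(1) by auto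
qed

lemma prod_roots_B_split:
  fixes f :: "(nat \<Rightarrow> int) \<Rightarrow> 'a :: comm_monoid_mult"
  shows "prod f (roots_B (n + r)) = prod f (roots_B n) *
    (\<Prod>i<n. \<Prod>k<r. f (long_root i (n + k) 1 1) * f (long_root i (n + k) 1 (-1)) *
       f (long_root i (n + k) (-1) 1) * f (long_root i (n + k) (-1) (-1))) *
    ((\<Prod>k<r. f (short_root (n + k) 1) * f (short_root (n + k) (-1))) *
     (\<Prod>k<r. \<Prod>l<k. f (long_root (n + l) (n + k) 1 1) * f (long_root (n + l) (n + k) 1 (-1)) *
       f (long_root (n + l) (n + k) (-1) 1) * f (long_root (n + l) (n + k) (-1) (-1))))"
  unfolding prod_roots_B prod_pairs_add prod_lessThan_add by (simp only: mult_ac)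

text \<open>For an even function the two ends of \<open>telescope\<close> with \<open>c = 0\<close> share the factor \<open>h p\<close>. It cannot
  be cancelled, as it may be \<open>0\<close>, so the reduced identity is proved by its own induction.\<close>
lemma telescope_even:
  fixes h :: "int \<Rightarrow> 'a :: comm_ring_1"
  assumes even: "\<And>j. h (- j) = h j"
  shows "(\<Prod>k<2 * p. h (expo k) * h (- expo k)) * h (int p + 1) =
    h (int p - 1) * (\<Prod>k<2 * p. h (expo k - 1) * h (- expo k - 1))"
proof (induction p)
  case 0
  then show ?case using even[of 1] by simp
next
  case (Suc p)
  let ?A = "\<Prod>k<2 * p. h (expo k) * h (- expo k)" and ?B = "\<Prod>k<2 * p. h (expo k - 1) * h (- expo k - 1)"
  have e: "h (- int p) = h (int p)" "h (- (int p + 1)) = h (int p + 1)" "h (- int p - 1) = h (int p + 1)"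
     "h (- (int p + 1) - 1) = h (2 + int p)"
  proof -
    have "- int p - 1 = - (int p + 1)" "- (int p + 1) - 1 = - (2 + int p)" by simp_all
    then show "h (- int p) = h (int p)" "h (- (int p + 1)) = h (int p + 1)" "h (- int p - 1) = h (int p + 1)"
      "h (- (int p + 1) - 1) = h (2 + int p)" by (simp_all only: even)
  qed
  have "(\<Prod>k<2 * Suc p. h (expo k) * h (- expo k)) * h (int (Suc p) + 1) =
    (?A * h (int p + 1)) * (h (int p) * h (int p) * h (int p + 1) * h (2 + int p))"
    unfolding prod_lessThan_double_Suc expo_even expo_odd e by (simp add: mult_ac)
  also have "\<dots> = (h (int p - 1) * ?B) * (h (int p) * h (int p) * h (int p + 1) * h (2 + int p))"
    by (simp only: Suc.IH)
  also have "\<dots> = h (int (Suc p) - 1) * (\<Prod>k<2 * Suc p. h (expo k - 1) * h (- expo k - 1))"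
    unfolding prod_lessThan_double_Suc expo_even expo_odd e by (simp add: mult_ac)
  finally show ?case .
qed

text \<open>Up to powers of \<open>q\<close>, the factors for \<open>x\<close> and \<open>1/x\<close> combine to values of the even function
  \<open>h j = q\<^bsup>j\<^esup> + q\<^bsup>-j\<^esup> - x - 1/x\<close>, to which \<open>telescope_even\<close> applies.\<close>
lemma mixed_telescope:
  fixes x :: complex and q :: real
  assumes q: "q > 0" and x: "x \<noteq> 0"
  shows "(1 - of_real (q powi (- int p - 1)) * inverse x) * (1 - of_real (q powi (- int p - 1)) * x) *
      (\<Prod>k<2 * p. (1 - inverse x * of_real (q powi expo k)) * (1 - inverse x * of_real (q powi (- expo k))) *
         ((1 - x * of_real (q powi expo k)) * (1 - x * of_real (q powi (- expo k))))) =
    of_real (q powi (4 * int p - 2)) *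
    ((1 - of_real (q powi (1 - int p)) * inverse x) * (1 - of_real (q powi (1 - int p)) * x) *
      (\<Prod>k<2 * p. (1 - inverse x * of_real (q powi (expo k - 1))) * (1 - inverse x * of_real (q powi (- expo k - 1))) *
         ((1 - x * of_real (q powi (expo k - 1))) * (1 - x * of_real (q powi (- expo k - 1))))))"
proof -
  \<comment> \<open>the symmetric form of \<open>(1 - x q\<^bsup>j\<^esup>) (1 - q\<^bsup>j\<^esup> / x)\<close>\<close>
  define h where "h = (\<lambda>j. of_real (q powi j) + of_real (q powi (- j)) - x - inverse x)"
  have pair: "(1 - inverse x * of_real (q powi j)) * (1 - x * of_real (q powi j)) = of_real (q powi j) * h j" for j
  proof -
    have "of_real (q powi j) * (of_real (q powi (- j)) :: complex) = 1"
      using q unfolding of_real_mult[symmetric] by (subst power_int_add[symmetric]) auto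
    then show ?thesis using x by (simp add: h_def algebra_simps)
  qed
  have pair': "(1 - of_real (q powi j) * inverse x) * (1 - of_real (q powi j) * x) = of_real (q powi j) * h j" for j
    using pair[of j] by (simp add: mult.commute)
  have N: "(1 - inverse x * of_real (q powi i)) * (1 - inverse x * of_real (q powi j)) *
         ((1 - x * of_real (q powi i)) * (1 - x * of_real (q powi j))) =
     of_real (q powi (i + j)) * (h i * h j)" for i j
  proof -
    have "(1 - inverse x * of_real (q powi i)) * (1 - inverse x * of_real (q powi j)) *
         ((1 - x * of_real (q powi i)) * (1 - x * of_real (q powi j))) =
       ((1 - inverse x * of_real (q powi i)) * (1 - x * of_real (q powi i))) *
       ((1 - inverse x * of_real (q powi j)) * (1 - x * of_real (q powi j)))" by (simp only: mult_ac)
    then show ?thesis unfolding pair using q by (simp add: power_int_add)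
  qed
  have even: "h (- j) = h j" for j by (simp add: h_def)
  from telescope_even[of h p, OF even]
  have T: "(\<Prod>k<2 * p. h (expo k) * h (- expo k)) * h (int p + 1) =
    h (int p - 1) * (\<Prod>k<2 * p. h (expo k - 1) * h (- expo k - 1))" .
  have hm: "h (- int p - 1) = h (int p + 1)" "h (1 - int p) = h (int p - 1)"
    using even[of "int p + 1"] even[of "int p - 1"] by simp_all
  have D: "(\<Prod>k<2 * p. of_real (q powi (expo k - 1 + (- expo k - 1))) * (h (expo k - 1) * h (- expo k - 1))) =
    of_real (q powi (- 4 * int p)) * (\<Prod>k<2 * p. h (expo k - 1) * h (- expo k - 1))"
  proof -
    have "(q powi (- 2)) ^ (2 * p) = q powi (- 4 * int p)"
      using power_int_mult[of q "- 2" "int (2 * p)"] by (simp only: power_int_of_nat) simp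
    then have "(of_real (q powi (- 2)) :: complex) ^ (2 * p) = of_real (q powi (- 4 * int p))"
      by (metis of_real_power)
    then show ?thesis by (simp add: prod.distrib)
  qed
  have "q powi (- int p - 1) = q powi (4 * int p - 2) * (q powi (1 - int p) * q powi (- 4 * int p))"
  proof -
    have "q \<noteq> 0" using q by simp
    moreover have "- int p - 1 = (4 * int p - 2) + ((1 - int p) + (- 4 * int p))" by simp
    ultimately show ?thesis by (metis power_int_add)
  qed
  then have E: "of_real (q powi (- int p - 1)) =
     of_real (q powi (4 * int p - 2)) * (of_real (q powi (1 - int p)) * (of_real (q powi (- 4 * int p)) :: complex))"
    by (metis of_real_mult)
  show ?thesis
    unfolding N D unfolding pair' unfolding hm E using T by (simp add: mult_ac)
qed

declare torus_simps(1) [simp del]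

section \<open>The image is a residual coset\<close>

lemma prod_Diff_If:
  "finite A \<Longrightarrow> (\<Prod>a\<in>A - Z. g a) = (\<Prod>a\<in>A. if a \<in> Z then 1 else g a)"
  for g :: "'b \<Rightarrow> 'a :: comm_monoid_mult"
  by (rule prod.mono_neutral_cong_left) auto

lemma card_as_power:
  "finite A \<Longrightarrow> Z \<subseteq> A \<Longrightarrow> (\<Prod>a\<in>A. if a \<in> Z then 2 else 1 :: real) = 2 ^ card Z"
proof -
  assume "finite A" "Z \<subseteq> A"
  then have "(\<Prod>a\<in>A. if a \<in> Z then 2 else 1 :: real) = (\<Prod>a\<in>Z. 2)"
    by (intro prod.mono_neutral_cong_right) auto
  then show ?thesis by simp
qed

text \<open>The value of \<open>b\<close> is the same for the parameters \<open>m\<^sub>+ - 2\<close> and \<open>m\<^sub>+\<close>, here \<open>x - 1\<close> and \<open>x + 1\<close>.\<close>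
lemma b_par_shift: "b_par mm (x - 1) = b_par mm (x + 1)"
proof -
  have shift: "y - 2 \<in> \<int> \<longleftrightarrow> y \<in> \<int>" for y :: real
    using Ints_add[of "y - 2" 2] Ints_diff[of y 2] by auto
  have "x - 1 + mm = x + 1 + mm - 2" "x - 1 - mm = x + 1 - mm - 2" by simp_all
  then show ?thesis unfolding b_par_def by (simp only: shift)
qed

locale strip_transfer =
  fixes n p :: nat and mm v :: real and P Q :: "(nat \<Rightarrow> int) set"
  assumes v: "v > 1" and half: "2 * mm \<in> \<int>"
    and P: "positive_system n P" and Q: "positive_system (n + 2 * p) Q"
begin

abbreviation "b \<equiv> b_par mm (real p + 1)"
definition "q = v ^ (2 * b)"
abbreviation "N \<equiv> n + 2 * p"
abbreviation "H1 \<equiv> hecke_B n P mm (real p + 1)"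
abbreviation "H2 \<equiv> hecke_B (n + 2 * p) Q mm (real p - 1)"
abbreviation "\<phi> \<equiv> strip_embed n p q"
abbreviation "L \<equiv> \<phi> ` carrier (torus n)"

lemma b_pos: "b > 0" by (simp add: b_par_def)

lemma q_gt_1: "q > 1" unfolding q_def using v b_pos by (intro one_less_power) simp_all

lemma q_pos: "q > 0" using q_gt_1 by simp

lemma q_powr: "q powr x = v powr (2 * real b * x)"
  using v by (simp add: q_def powr_realpow[symmetric] powr_powr)

lemma q_powi: "q powi k = v powr (2 * real b * of_int k)"
  using q_pos by (simp add: q_powr[symmetric] powr_real_of_int')

lemma params_H2:
  "hrank H2 = N" "hpos H2 = Q"
  "v powr (-2 * hm_plus H2 a) = (if a \<in> long_roots N then q powi (-1) else q powi (1 - int p))"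
  "v powr (-2 * hm_minus H2 a) = (if a \<in> long_roots N then 1 else q powr (- mm))"
  unfolding q_powi q_powr using v by (simp_all add: hecke_B_def b_par_shift Let_def algebra_simps)

lemma params_H1:
  "hrank H1 = n" "hpos H1 = P"
  "v powr (-2 * hm_plus H1 a) = (if a \<in> long_roots n then q powi (-1) else q powi (- int p - 1))"
  "v powr (-2 * hm_minus H1 a) = (if a \<in> long_roots n then 1 else q powr (- mm))"
  unfolding q_powi q_powr using v by (auto simp: hecke_B_def Let_def algebra_simps intro!: arg_cong[where f = "\<lambda>x. v powr x"])

lemma generic_mem: "\<phi> (generic_point n) \<in> L"
  using generic_point_mem by blast

lemma head_not_real:
  assumes "a \<in> roots_B N" "\<forall>t\<in>L. char_val N a t = of_real (x t)" shows "\<forall>i<n. a i = 0"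
  using head_root_value[OF assms(1) _ q_pos] assms(2) generic_mem by force

lemma z_minus_L: "z_minus H2 L = {}"
proof -
  have False if a: "a \<in> roots_B N" "\<forall>t\<in>L. - char_val N a t = 1" for a
  proof -
    have "\<forall>t\<in>L. char_val N a t = of_real (- 1)"
      using a(2) by (metis minus_equation_iff of_real_1 of_real_minus)
    from head_not_real[OF a(1) this] obtain c where
      "\<And>t. char_val N a (\<phi> t) = of_real (q powi c)" using tail_root_value[OF a(1) _ q_pos] by blast
    then have "- of_real (q powi c) = (1 :: complex)" using a(2) generic_mem by metis
    then have "- (q powi c) = 1" by (metis of_real_eq_1_iff of_real_minus)
    then show False using zero_less_power_int[OF q_pos, of c] by linarith
  qed
  then show ?thesis unfolding z_minus_def params_H2 by blast
qed

lemma p_minus_L: "p_minus H2 v L = {}"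
proof -
  have False if a: "a \<in> roots_B N" "\<forall>t\<in>L. - char_val N a t = of_real x" and x: "x > 0" for a x
  proof -
    have "\<forall>t\<in>L. char_val N a t = of_real (- x)"
      using a(2) by (metis minus_equation_iff of_real_minus)
    from head_not_real[OF a(1) this] obtain c where
      "\<And>t. char_val N a (\<phi> t) = of_real (q powi c)" using tail_root_value[OF a(1) _ q_pos] by blast
    then have "- of_real (q powi c) = (of_real x :: complex)" using a(2) generic_mem by metis
    then have "- (q powi c) = x" by (metis of_real_eq_iff of_real_minus)
    then show False using zero_less_power_int[OF q_pos, of c] x by linarith
  qed
  moreover have "v powr (-2 * hm_minus H2 a) > 0" for a using v by simp
  ultimately show ?thesis unfolding p_minus_def params_H2(1) by blast
qed

lemma z_plus_head: "a \<in> z_plus H2 L \<Longrightarrow> \<forall>i<n. a i = 0"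
  using head_not_real[of a "\<lambda>_. 1"] by (simp add: z_plus_def params_H2)

lemma p_plus_head: "a \<in> p_plus H2 v L \<Longrightarrow> \<forall>i<n. a i = 0"
  using head_not_real[of a "\<lambda>_. v powr (-2 * hm_plus H2 a)"] by (simp add: p_plus_def params_H2(1))

lemma plus_tail:
  assumes a: "a \<in> roots_B N" and c: "\<And>t. char_val N a (\<phi> t) = of_real (q powi c)"
    and m: "v powr (-2 * hm_plus H2 a) = q powi m"
  shows "a \<in> z_plus H2 L \<longleftrightarrow> - c = 0" "a \<in> p_plus H2 v L \<longleftrightarrow> m - c = 0"
proof -
  have L: "(\<forall>t\<in>L. char_val N a t = of_real x) \<longleftrightarrow> q powi c = x" for x
    using generic_mem unfolding ball_simps c of_real_eq_iff by blast
  have "q powi c = 1 \<longleftrightarrow> - c = 0" using powi_eq_one_real[OF q_gt_1] by auto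
  then show "a \<in> z_plus H2 L \<longleftrightarrow> - c = 0"
    using L[of 1] a by (simp add: z_plus_def params_H2(1))
  have "q powi c = q powi m \<longleftrightarrow> q powi (m - c) = 1"
    using q_pos by (auto simp: power_int_diff)
  then have "q powi c = q powi m \<longleftrightarrow> m - c = 0" using powi_eq_one_real[OF q_gt_1] by auto
  then show "a \<in> p_plus H2 v L \<longleftrightarrow> m - c = 0"
    using L[of "q powi m"] a by (simp only: p_plus_def params_H2(1) m mem_Collect_eq simp_thms)
qed

lemma short_mem: "k < 2 * p \<Longrightarrow> s \<in> {1, -1} \<Longrightarrow> short_root (n + k) s \<in> short_roots N"
  by (rule short_root_mem) auto

lemma short_not_long: "a \<in> short_roots M \<Longrightarrow> a \<notin> long_roots M"
  using short_long_disjoint by blast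

lemma plus_tail_short:
  assumes "k < 2 * p" "s \<in> {1, -1}"
  shows "short_root (n + k) s \<in> z_plus H2 L \<longleftrightarrow> - s * expo k = 0"
    "short_root (n + k) s \<in> p_plus H2 v L \<longleftrightarrow> 1 - int p - s * expo k = 0"
proof -
  have S: "short_root (n + k) s \<in> roots_B N" "short_root (n + k) s \<notin> long_roots N"
    using short_mem[OF assms] short_not_long by (auto simp: roots_B_def)
  have "v powr (-2 * hm_plus H2 (short_root (n + k) s)) = q powi (1 - int p)"
    using S(2) by (simp only: params_H2 if_False)
  from plus_tail[OF S(1) tail_short_value[OF assms(1) q_pos assms(2)] this]
  show "short_root (n + k) s \<in> z_plus H2 L \<longleftrightarrow> - s * expo k = 0"
    "short_root (n + k) s \<in> p_plus H2 v L \<longleftrightarrow> 1 - int p - s * expo k = 0" by simp_all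
qed

lemma plus_tail_long:
  assumes "l < k" "k < 2 * p" "s \<in> {1, -1}" "u \<in> {1, -1}"
  shows "long_root (n + l) (n + k) s u \<in> z_plus H2 L \<longleftrightarrow> - (s * expo l + u * expo k) = 0"
    "long_root (n + l) (n + k) s u \<in> p_plus H2 v L \<longleftrightarrow> - 1 - (s * expo l + u * expo k) = 0"
proof -
  have S: "long_root (n + l) (n + k) s u \<in> long_roots N" "long_root (n + l) (n + k) s u \<in> roots_B N"
    using long_root_mem[of "n + l" "n + k" N s u] assms by (auto simp: roots_B_def)
  have "v powr (-2 * hm_plus H2 (long_root (n + l) (n + k) s u)) = q powi (- 1)"
    using S(1) by (simp only: params_H2 if_True)
  from plus_tail[OF S(2) tail_long_value[OF assms(1,2) q_pos assms(3,4)] this]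
  show "long_root (n + l) (n + k) s u \<in> z_plus H2 L \<longleftrightarrow> - (s * expo l + u * expo k) = 0"
    "long_root (n + l) (n + k) s u \<in> p_plus H2 v L \<longleftrightarrow> - 1 - (s * expo l + u * expo k) = 0"
    by simp_all
qed

lemma prod_tail_support:
  fixes f :: "(nat \<Rightarrow> int) \<Rightarrow> real"
  assumes "\<And>a. \<exists>i<n. a i \<noteq> 0 \<Longrightarrow> f a = 1"
  shows "prod f (roots_B N) = (\<Prod>k<2 * p. f (short_root (n + k) 1) * f (short_root (n + k) (-1))) *
     (\<Prod>k<2 * p. \<Prod>l<k. f (long_root (n + l) (n + k) 1 1) * f (long_root (n + l) (n + k) 1 (-1)) *
       f (long_root (n + l) (n + k) (-1) 1) * f (long_root (n + l) (n + k) (-1) (-1)))"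
proof -
  have "prod f (roots_B n) = 1"
  proof (rule prod.neutral, rule ballI)
    fix a assume "a \<in> roots_B n"
    then show "f a = 1"
    proof (cases rule: roots_B_cases)
      case (short i s) then show ?thesis by (intro assms exI[of _ i]) (auto simp: short_root_def)
    next
      case (long i j s u) then show ?thesis by (intro assms exI[of _ i]) (auto simp: long_root_def)
    qed
  qed
  moreover have "f (long_root i j s u) = 1" if "i < n" "s \<in> {1, -1}" for i j s u
    using that by (intro assms exI[of _ i]) (auto simp: long_root_def)
  ultimately show ?thesis unfolding prod_roots_B_split by simp
qed

text \<open>Comparing powers of \<open>2\<close> turns the count of roots into the product evaluated in \<open>tail_order\<close>.\<close>
lemma residual: "residual_coset H2 v L"
proof -
  define f :: "int \<Rightarrow> real" where "f = (\<lambda>k. if k = 0 then 2 else 1)"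
  have nz: "f k \<noteq> 0" for k by (simp add: f_def)
  have Z: "2 ^ card (z_plus H2 L) = (\<Prod>k<2 * p. f (expo k) * f (- expo k)) *
     (\<Prod>k<2 * p. \<Prod>l<k. f (expo k + expo l) * f (expo k - expo l) * f (- expo k + expo l) * f (- expo k - expo l))"
  proof -
    have "2 ^ card (z_plus H2 L) = (\<Prod>a\<in>roots_B N. if a \<in> z_plus H2 L then 2 else 1 :: real)"
      by (rule card_as_power[symmetric]) (auto simp: finite_roots_B z_plus_def params_H2)
    also have "\<dots> = (\<Prod>k<2 * p. f (- expo k) * f (expo k)) *
     (\<Prod>k<2 * p. \<Prod>l<k. f (- (expo l + expo k)) * f (- (expo l - expo k)) * f (- (- expo l + expo k)) * f (- (- expo l - expo k)))"
      by (subst prod_tail_support) (use z_plus_head in \<open>auto simp: plus_tail_short plus_tail_long f_def intro!: prod.cong arg_cong2[where f = "(*)"]\<close>)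
    also have "\<dots> = (\<Prod>k<2 * p. f (expo k) * f (- expo k)) *
     (\<Prod>k<2 * p. \<Prod>l<k. f (expo k + expo l) * f (expo k - expo l) * f (- expo k + expo l) * f (- expo k - expo l))"
    proof -
      have "f (- (x + y)) * f (- (x - y)) * f (- (- x + y)) * f (- (- x - y)) =
        f (y + x) * f (y - x) * f (- y + x) * f (- y - x)" for x y
      proof -
        have "- (x + y) = - y - x" "- (x - y) = y - x" "- (- x + y) = - y + x" "- (- x - y) = y + x" by simp_all
        from this[THEN arg_cong[where f = f]] show ?thesis by (simp only: mult_ac)
      qed
      then show ?thesis by (simp only:) (simp only: mult.commute)
    qed
    finally show ?thesis .
  qed
  have PP: "2 ^ card (p_plus H2 v L) = (\<Prod>k<2 * p. f (1 - int p + expo k) * f (1 - int p - expo k)) *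
     (\<Prod>k<2 * p. \<Prod>l<k. f (expo k + expo l - 1) * f (expo k - expo l - 1) *
        f (- expo k + expo l - 1) * f (- expo k - expo l - 1))"
  proof -
    have "2 ^ card (p_plus H2 v L) = (\<Prod>a\<in>roots_B N. if a \<in> p_plus H2 v L then 2 else 1 :: real)"
      by (rule card_as_power[symmetric]) (auto simp: finite_roots_B p_plus_def params_H2)
    also have "\<dots> = (\<Prod>k<2 * p. f (1 - int p - expo k) * f (1 - int p + expo k)) *
     (\<Prod>k<2 * p. \<Prod>l<k. f (- 1 - (expo l + expo k)) * f (- 1 - (expo l - expo k)) *
        f (- 1 - (- expo l + expo k)) * f (- 1 - (- expo l - expo k)))"
      by (subst prod_tail_support) (use p_plus_head in \<open>auto simp: plus_tail_short plus_tail_long f_def intro!: prod.cong arg_cong2[where f = "(*)"]\<close>)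
    also have "\<dots> = (\<Prod>k<2 * p. f (1 - int p + expo k) * f (1 - int p - expo k)) *
     (\<Prod>k<2 * p. \<Prod>l<k. f (expo k + expo l - 1) * f (expo k - expo l - 1) *
        f (- expo k + expo l - 1) * f (- expo k - expo l - 1))"
    proof -
      have "f (- 1 - (x + y)) * f (- 1 - (x - y)) * f (- 1 - (- x + y)) * f (- 1 - (- x - y)) =
        f (y + x - 1) * f (y - x - 1) * f (- y + x - 1) * f (- y - x - 1)" for x y
      proof -
        have "- 1 - (x + y) = - y - x - 1" "- 1 - (x - y) = y - x - 1" "- 1 - (- x + y) = - y + x - 1"
          "- 1 - (- x - y) = y + x - 1" by simp_all
        from this[THEN arg_cong[where f = f]] show ?thesis by (simp only: mult_ac)
      qed
      then show ?thesis by (simp only:) (simp only: mult.commute)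
    qed
    finally show ?thesis .
  qed
  have "tail_short f p * tail_long f p = 2 ^ card (z_plus H2 L) / 2 ^ card (p_plus H2 v L)"
    unfolding Z PP tail_short_def tail_long_def pair_quot_def prod_dividef by simp
  moreover have "tail_short f p * tail_long f p * 4 ^ p = 1" unfolding f_def by (rule tail_order)
  ultimately have "2 ^ card (z_plus H2 L) / 2 ^ card (p_plus H2 v L) * 4 ^ p = (1 :: real)"
    by (simp only:)
  then have "(2 :: real) ^ card (p_plus H2 v L) = 2 ^ card (z_plus H2 L) * 4 ^ p"
    by (simp add: field_simps)
  also have "\<dots> = 2 ^ (card (z_plus H2 L) + 2 * p)" by (simp add: power_add power_mult)
  finally have "card (p_plus H2 v L) = card (z_plus H2 L) + 2 * p" by simp
  then show ?thesis
    unfolding residual_coset_def params_H2(1) z_minus_L p_minus_L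
    using strip_embed_coset[OF q_pos, of n p] by (intro exI[of _ n]) simp
qed

end

context strip_transfer begin

section \<open>Pulling back the regularised mu-function\<close>

definition num_factor :: "(nat \<Rightarrow> int) \<Rightarrow> (nat \<Rightarrow> complex) \<Rightarrow> complex" where
  "num_factor a s = (1 + inverse (char_val N a s)) *
     (if a \<in> z_plus H2 L then 1 else 1 - inverse (char_val N a s))"

definition den_factor :: "(nat \<Rightarrow> int) \<Rightarrow> (nat \<Rightarrow> complex) \<Rightarrow> complex" where
  "den_factor a s = (1 + of_real (v powr (-2 * hm_minus H2 a)) * inverse (char_val N a s)) *
     (if a \<in> p_plus H2 v L then 1 else 1 - of_real (v powr (-2 * hm_plus H2 a)) * inverse (char_val N a s))"

definition den_source :: "(nat \<Rightarrow> int) \<Rightarrow> (nat \<Rightarrow> complex) \<Rightarrow> complex" where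
  "den_source a t = (1 - of_real (v powr (-2 * hm_plus H1 a)) * inverse (char_val n a t)) *
     (1 + of_real (v powr (-2 * hm_minus H1 a)) * inverse (char_val n a t))"

lemma mu_reg_factors:
  "fst (mu_reg H2 v L) s = of_real (mu_const H2 v) * (\<Prod>a\<in>roots_B N. num_factor a s)"
  "snd (mu_reg H2 v L) s = (\<Prod>a\<in>roots_B N. den_factor a s)"
  unfolding mu_reg_def Let_def params_H2(1) fst_conv snd_conv z_minus_L p_minus_L prod_Diff_If[OF finite_roots_B]
    num_factor_def den_factor_def prod.distrib by (simp_all add: mult.assoc)

lemma mu_fun_factors:
  "fst (mu_fun H1 v) t = of_real (mu_const H1 v) * (\<Prod>a\<in>roots_B n. 1 - inverse ((char_val n a t)\<^sup>2))"
  "snd (mu_fun H1 v) t = (\<Prod>a\<in>roots_B n. den_source a t)"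
  unfolding mu_fun_def Let_def params_H1(1) den_source_def by simp_all

lemma head_root:
  assumes "a \<in> roots_B n"
  shows "char_val N a (\<phi> t) = char_val n a t" "a \<notin> z_plus H2 L" "a \<notin> p_plus H2 v L"
    "a \<in> roots_B N"
proof -
  have *: "(\<forall>k<2 * p. a (n + k) = 0) \<and> (\<exists>i<n. a i \<noteq> 0) \<and> a \<in> roots_B N"
    using assms
  proof (cases rule: roots_B_cases)
    case (short i s)
    then show ?thesis using short_root_mem[of i N s] by (auto simp: short_root_def roots_B_def)
  next
    case (long i j s u)
    then show ?thesis using long_root_mem[of i j N s u] by (auto simp: long_root_def roots_B_def)
  qed
  then show "char_val N a (\<phi> t) = char_val n a t" by (intro char_val_head) blast
  show "a \<notin> z_plus H2 L" "a \<notin> p_plus H2 v L" "a \<in> roots_B N"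
    using * z_plus_head p_plus_head by blast+
qed

lemma num_factor_head:
  "a \<in> roots_B n \<Longrightarrow> num_factor a (\<phi> t) = 1 - inverse ((char_val n a t)\<^sup>2)"
  unfolding num_factor_def
  by (simp only: head_root if_False) (simp add: power2_eq_square algebra_simps)

lemma factors_mixed:
  assumes "i < n" "k < 2 * p" "s \<in> {1, -1}" "u \<in> {1, -1}" and y: "y = inverse (t i powi s) * of_real (q powi (- u * expo k))"
  shows "num_factor (long_root i (n + k) s u) (\<phi> t) = (1 + y) * (1 - y)"
    "den_factor (long_root i (n + k) s u) (\<phi> t) = (1 + y) * (1 - of_real (q powi (- 1)) * y)"
proof -
  let ?a = "long_root i (n + k) s u"
  have "?a i \<noteq> 0" using assms by (auto simp: long_root_def)
  then have nz: "?a \<notin> z_plus H2 L" "?a \<notin> p_plus H2 v L" using z_plus_head p_plus_head assms(1) by blast+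
  have "?a \<in> long_roots N" using assms by (intro long_root_mem) auto
  then have par: "v powr (-2 * hm_plus H2 ?a) = q powi (- 1)" "v powr (-2 * hm_minus H2 ?a) = 1"
    by (simp_all only: params_H2 if_True)
  have "inverse (char_val N ?a (\<phi> t)) = y"
    unfolding mixed_value[OF assms(1,2) q_pos assms(3,4)] y by (simp add: power_int_minus del: of_real_power_int)
  then show "num_factor ?a (\<phi> t) = (1 + y) * (1 - y)"
    "den_factor ?a (\<phi> t) = (1 + y) * (1 - of_real (q powi (- 1)) * y)"
    using nz unfolding num_factor_def den_factor_def par by simp_all
qed

lemma short_pair:
  assumes i: "i < n"
  shows "den_source (short_root i 1) t * den_source (short_root i (-1)) t =
      (1 - of_real (q powi (- int p - 1)) * inverse (t i)) * (1 - of_real (q powi (- int p - 1)) * t i) *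
      ((1 + of_real (q powr (- mm)) * inverse (t i)) * (1 + of_real (q powr (- mm)) * t i))"
    "den_factor (short_root i 1) (\<phi> t) * den_factor (short_root i (-1)) (\<phi> t) =
      (1 - of_real (q powi (1 - int p)) * inverse (t i)) * (1 - of_real (q powi (1 - int p)) * t i) *
      ((1 + of_real (q powr (- mm)) * inverse (t i)) * (1 + of_real (q powr (- mm)) * t i))"
proof -
  have S: "short_root i s \<in> roots_B n" "short_root i s \<notin> long_roots n" "short_root i s \<notin> long_roots N"
    if "s \<in> {1, -1}" for s
    using short_root_mem[of i n s] short_root_mem[of i N s] short_not_long that i by (auto simp: roots_B_def)
  have c: "char_val n (short_root i 1) t = t i" "char_val n (short_root i (-1)) t = inverse (t i)"
    using i by (simp_all add: char_val_short_root power_int_minus)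
  show "den_source (short_root i 1) t * den_source (short_root i (-1)) t =
      (1 - of_real (q powi (- int p - 1)) * inverse (t i)) * (1 - of_real (q powi (- int p - 1)) * t i) *
      ((1 + of_real (q powr (- mm)) * inverse (t i)) * (1 + of_real (q powr (- mm)) * t i))"
    unfolding den_source_def params_H1 c using S[of 1] S[of "-1"] by simp
  show "den_factor (short_root i 1) (\<phi> t) * den_factor (short_root i (-1)) (\<phi> t) =
      (1 - of_real (q powi (1 - int p)) * inverse (t i)) * (1 - of_real (q powi (1 - int p)) * t i) *
      ((1 + of_real (q powr (- mm)) * inverse (t i)) * (1 + of_real (q powr (- mm)) * t i))"
    unfolding den_factor_def params_H2 using S[of 1] S[of "-1"]
      head_root(1)[of "short_root i 1" t] head_root(1)[of "short_root i (-1)" t]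
      head_root(3)[of "short_root i 1"] head_root(3)[of "short_root i (-1)"] by (simp add: c)
qed

lemma long_head:
  assumes "i < j" "j < n" "s \<in> {1, -1}" "u \<in> {1, -1}"
  shows "den_factor (long_root i j s u) (\<phi> t) = den_source (long_root i j s u) t"
proof -
  have S: "long_root i j s u \<in> roots_B n" "long_root i j s u \<in> long_roots n" "long_root i j s u \<in> long_roots N"
    using long_root_mem[of i j n s u] long_root_mem[of i j N s u] assms by (auto simp: roots_B_def)
  show ?thesis
    unfolding den_factor_def den_source_def params_H1 params_H2 using S head_root[OF S(1)] by simp
qed

abbreviation "num_mixed i t \<equiv> (\<Prod>k<2 * p. num_factor (long_root i (n + k) 1 1) (\<phi> t) *
   num_factor (long_root i (n + k) 1 (-1)) (\<phi> t) * num_factor (long_root i (n + k) (-1) 1) (\<phi> t) *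
   num_factor (long_root i (n + k) (-1) (-1)) (\<phi> t))"

abbreviation "den_mixed i t \<equiv> (\<Prod>k<2 * p. den_factor (long_root i (n + k) 1 1) (\<phi> t) *
   den_factor (long_root i (n + k) 1 (-1)) (\<phi> t) * den_factor (long_root i (n + k) (-1) 1) (\<phi> t) *
   den_factor (long_root i (n + k) (-1) (-1)) (\<phi> t))"

text \<open>The short head roots at one coordinate together with all mixed roots at it: the mixed roots change
  the parameter of the short ones by \<open>2\<close>. The factors \<open>1 + y\<close> cancel because \<open>m\<^sub>-\<close> vanishes on
  long roots.\<close>
lemma short_mixed:
  assumes i: "i < n" and t: "t i \<noteq> 0"
  shows "den_source (short_root i 1) t * den_source (short_root i (-1)) t * num_mixed i t =
    of_real (q powi (4 * int p - 2)) *
    (den_factor (short_root i 1) (\<phi> t) * den_factor (short_root i (-1)) (\<phi> t) * den_mixed i t)"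
proof -
  define Q :: "int \<Rightarrow> complex" where "Q = (\<lambda>j. of_real (q powi j))"
  have Qm: "Q (j - 1) = Q (- 1) * Q j" for j
  proof -
    have "q powi (j - 1) = q powi (- 1) * q powi j" using q_pos power_int_add[of q "- 1" j] by simp
    then show ?thesis unfolding Q_def by (simp only: of_real_mult)
  qed
  have Q1: "of_real (q powi (- 1)) = Q (- 1)" by (simp add: Q_def)
  define x where "x = t i"
  let ?c = "\<lambda>k. (1 + inverse x * Q (expo k)) * (1 + inverse x * Q (- expo k)) * ((1 + x * Q (expo k)) * (1 + x * Q (- expo k)))"
  have nm: "num_mixed i t = (\<Prod>k<2 * p. ?c k) * (\<Prod>k<2 * p. (1 - inverse x * Q (expo k)) * (1 - inverse x * Q (- expo k)) *
         ((1 - x * Q (expo k)) * (1 - x * Q (- expo k))))"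
    unfolding prod.distrib[symmetric]
  proof (rule prod.cong[OF refl])
    fix k assume "k \<in> {..<2 * p}"
    then have k: "k < 2 * p" by simp
    have "num_factor (long_root i (n + k) 1 1) (\<phi> t) = (1 + inverse x * Q (- expo k)) * (1 - inverse x * Q (- expo k))"
      "num_factor (long_root i (n + k) 1 (-1)) (\<phi> t) = (1 + inverse x * Q (expo k)) * (1 - inverse x * Q (expo k))"
      "num_factor (long_root i (n + k) (-1) 1) (\<phi> t) = (1 + x * Q (- expo k)) * (1 - x * Q (- expo k))"
      "num_factor (long_root i (n + k) (-1) (-1)) (\<phi> t) = (1 + x * Q (expo k)) * (1 - x * Q (expo k))"
      by (rule factors_mixed(1)[OF i k]; simp add: x_def Q_def power_int_minus)+
    then show "num_factor (long_root i (n + k) 1 1) (\<phi> t) *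
       num_factor (long_root i (n + k) 1 (-1)) (\<phi> t) * num_factor (long_root i (n + k) (-1) 1) (\<phi> t) *
       num_factor (long_root i (n + k) (-1) (-1)) (\<phi> t) = ?c k * ((1 - inverse x * Q (expo k)) * (1 - inverse x * Q (- expo k)) *
         ((1 - x * Q (expo k)) * (1 - x * Q (- expo k))))"
      by (simp only: mult_ac)
  qed
  have dm: "den_mixed i t = (\<Prod>k<2 * p. ?c k) * (\<Prod>k<2 * p. (1 - inverse x * Q (expo k - 1)) * (1 - inverse x * Q (- expo k - 1)) *
         ((1 - x * Q (expo k - 1)) * (1 - x * Q (- expo k - 1))))"
    unfolding prod.distrib[symmetric]
  proof (rule prod.cong[OF refl])
    fix k assume "k \<in> {..<2 * p}"
    then have k: "k < 2 * p" by simp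
    have "den_factor (long_root i (n + k) 1 1) (\<phi> t) = (1 + inverse x * Q (- expo k)) * (1 - of_real (q powi (- 1)) * (inverse x * Q (- expo k)))"
      "den_factor (long_root i (n + k) 1 (-1)) (\<phi> t) = (1 + inverse x * Q (expo k)) * (1 - of_real (q powi (- 1)) * (inverse x * Q (expo k)))"
      "den_factor (long_root i (n + k) (-1) 1) (\<phi> t) = (1 + x * Q (- expo k)) * (1 - of_real (q powi (- 1)) * (x * Q (- expo k)))"
      "den_factor (long_root i (n + k) (-1) (-1)) (\<phi> t) = (1 + x * Q (expo k)) * (1 - of_real (q powi (- 1)) * (x * Q (expo k)))"
      by (rule factors_mixed(2)[OF i k]; simp add: x_def Q_def power_int_minus)+
    then show "den_factor (long_root i (n + k) 1 1) (\<phi> t) *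
       den_factor (long_root i (n + k) 1 (-1)) (\<phi> t) * den_factor (long_root i (n + k) (-1) 1) (\<phi> t) *
       den_factor (long_root i (n + k) (-1) (-1)) (\<phi> t) = ?c k * ((1 - inverse x * Q (expo k - 1)) * (1 - inverse x * Q (- expo k - 1)) *
         ((1 - x * Q (expo k - 1)) * (1 - x * Q (- expo k - 1))))"
      unfolding Q1 Qm by (simp only: mult_ac)
  qed
  have cancel: "A * B = D * (E * F) \<Longrightarrow> A * X * (Y * B) = D * (E * X * (Y * F))" for A B D E F X Y :: complex
    by (metis mult.assoc mult.commute)
  show ?thesis
    unfolding short_pair[OF i] nm dm unfolding Q_def x_def by (rule cancel[OF mixed_telescope[OF q_pos t]])
qed

lemma head_mixed:
  assumes t: "t \<in> carrier (torus n)"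
  shows "(\<Prod>a\<in>roots_B n. den_source a t) * (\<Prod>i<n. num_mixed i t) =
    of_real (q powi ((4 * int p - 2) * int n)) * ((\<Prod>a\<in>roots_B n. den_factor a (\<phi> t)) * (\<Prod>i<n. den_mixed i t))"
proof -
  have tn: "t i \<noteq> 0" if "i < n" for i using t that by (simp add: torus_simps)
  let ?S = "\<lambda>i. den_source (short_root i 1) t * den_source (short_root i (-1)) t"
  let ?F = "\<lambda>i. den_factor (short_root i 1) (\<phi> t) * den_factor (short_root i (-1)) (\<phi> t)"
  define G where "G = (\<Prod>j<n. \<Prod>i<j. den_source (long_root i j 1 1) t * den_source (long_root i j 1 (-1)) t *
       den_source (long_root i j (-1) 1) t * den_source (long_root i j (-1) (-1)) t)"
  have "(\<Prod>j<n. \<Prod>i<j. den_factor (long_root i j 1 1) (\<phi> t) * den_factor (long_root i j 1 (-1)) (\<phi> t) *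
       den_factor (long_root i j (-1) 1) (\<phi> t) * den_factor (long_root i j (-1) (-1)) (\<phi> t)) = G"
    unfolding G_def by (intro prod.cong refl) (simp add: long_head)
  then have "(\<Prod>a\<in>roots_B n. den_factor a (\<phi> t)) = (\<Prod>i<n. ?F i) * G" by (simp only: prod_roots_B)
  moreover have "(\<Prod>a\<in>roots_B n. den_source a t) = (\<Prod>i<n. ?S i) * G"
    unfolding G_def by (rule prod_roots_B)
  moreover have "(\<Prod>i<n. ?S i) * (\<Prod>i<n. num_mixed i t) =
      of_real (q powi ((4 * int p - 2) * int n)) * ((\<Prod>i<n. ?F i) * (\<Prod>i<n. den_mixed i t))"
  proof -
    have "(\<Prod>i<n. ?S i) * (\<Prod>i<n. num_mixed i t) = (\<Prod>i<n. ?S i * num_mixed i t)"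
      by (rule prod.distrib[symmetric])
    also have "\<dots> = (\<Prod>i<n. of_real (q powi (4 * int p - 2)) * (?F i * den_mixed i t))"
      by (intro prod.cong refl short_mixed) (simp_all only: tn lessThan_iff not_False_eq_True)
    also have "\<dots> = of_real (q powi (4 * int p - 2)) ^ n * ((\<Prod>i<n. ?F i) * (\<Prod>i<n. den_mixed i t))"
      by (simp only: prod.distrib prod_constant card_lessThan)
    also have "of_real (q powi (4 * int p - 2)) ^ n = (of_real (q powi ((4 * int p - 2) * int n)) :: complex)"
      by (simp only: power_int_mult power_int_of_nat of_real_power)
    finally show ?thesis .
  qed
  ultimately show ?thesis by (simp only: mult_ac)
qed

lemma tail_factors:
  assumes a: "a \<in> roots_B N" and c: "\<And>t. char_val N a (\<phi> t) = of_real (q powi c)"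
    and m: "v powr (-2 * hm_plus H2 a) = q powi m"
  shows "num_factor a (\<phi> t) = of_real ((1 + q powi (- c)) * reg_factor q (- c))"
    "den_factor a (\<phi> t) = of_real ((1 + v powr (-2 * hm_minus H2 a) * q powi (- c)) * reg_factor q (m - c))"
proof -
  have i: "inverse (char_val N a (\<phi> t)) = of_real (q powi (- c))"
    unfolding c by (simp add: power_int_minus)
  show "num_factor a (\<phi> t) = of_real ((1 + q powi (- c)) * reg_factor q (- c))"
    unfolding num_factor_def i plus_tail(1)[OF a c m] reg_factor_def by (simp del: of_real_power_int)
  have "q powi m * q powi (- c) = q powi (m - c)" using q_pos power_int_add[of q m "- c"] by simp
  then have mc: "of_real (q powi m) * of_real (q powi (- c)) = (of_real (q powi (m - c)) :: complex)"
    by (simp only: of_real_mult[symmetric])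
  show "den_factor a (\<phi> t) = of_real ((1 + v powr (-2 * hm_minus H2 a) * q powi (- c)) * reg_factor q (m - c))"
    unfolding den_factor_def i plus_tail(2)[OF a c m] reg_factor_def m mc
    by (simp del: of_real_power_int)
qed

end

context strip_transfer begin

text \<open>The part of the tail denominator that depends on \<open>m\<^sub>-\<close>.\<close>
definition tail_minus :: real where
  "tail_minus = (\<Prod>k<2 * p. (1 + q powr (- mm) * q powi (- expo k)) * (1 + q powr (- mm) * q powi expo k))"

abbreviation "num_tail t \<equiv>
  (\<Prod>k<2 * p. num_factor (short_root (n + k) 1) (\<phi> t) * num_factor (short_root (n + k) (-1)) (\<phi> t)) *
  (\<Prod>k<2 * p. \<Prod>l<k. num_factor (long_root (n + l) (n + k) 1 1) (\<phi> t) * num_factor (long_root (n + l) (n + k) 1 (-1)) (\<phi> t) *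
     num_factor (long_root (n + l) (n + k) (-1) 1) (\<phi> t) * num_factor (long_root (n + l) (n + k) (-1) (-1)) (\<phi> t))"

abbreviation "den_tail t \<equiv>
  (\<Prod>k<2 * p. den_factor (short_root (n + k) 1) (\<phi> t) * den_factor (short_root (n + k) (-1)) (\<phi> t)) *
  (\<Prod>k<2 * p. \<Prod>l<k. den_factor (long_root (n + l) (n + k) 1 1) (\<phi> t) * den_factor (long_root (n + l) (n + k) 1 (-1)) (\<phi> t) *
     den_factor (long_root (n + l) (n + k) (-1) 1) (\<phi> t) * den_factor (long_root (n + l) (n + k) (-1) (-1)) (\<phi> t))"

lemma tail_short_factors:
  assumes k: "k < 2 * p" and s: "s \<in> {1, -1}"
  shows "num_factor (short_root (n + k) s) (\<phi> t) = of_real ((1 + q powi (- (s * expo k))) * reg_factor q (- (s * expo k)))"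
    "den_factor (short_root (n + k) s) (\<phi> t) =
      of_real ((1 + q powr (- mm) * q powi (- (s * expo k))) * reg_factor q (1 - int p - s * expo k))"
proof -
  have S: "short_root (n + k) s \<in> roots_B N" "short_root (n + k) s \<notin> long_roots N"
    using short_mem[OF assms] short_not_long by (auto simp: roots_B_def)
  have m: "v powr (-2 * hm_plus H2 (short_root (n + k) s)) = q powi (1 - int p)"
    "v powr (-2 * hm_minus H2 (short_root (n + k) s)) = q powr (- mm)"
    using S(2) by (simp_all only: params_H2 if_False)
  from tail_factors[OF S(1) tail_short_value[OF k q_pos s] m(1)]
  show "num_factor (short_root (n + k) s) (\<phi> t) = of_real ((1 + q powi (- (s * expo k))) * reg_factor q (- (s * expo k)))"
    "den_factor (short_root (n + k) s) (\<phi> t) =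
      of_real ((1 + q powr (- mm) * q powi (- (s * expo k))) * reg_factor q (1 - int p - s * expo k))"
    unfolding m(2) by blast+
qed

lemma tail_long_factors:
  assumes lk: "l < k" "k < 2 * p" and su: "s \<in> {1, -1}" "u \<in> {1, -1}"
    and c: "c = - (s * expo l + u * expo k)"
  shows "num_factor (long_root (n + l) (n + k) s u) (\<phi> t) = of_real ((1 + q powi c) * reg_factor q c)"
    "den_factor (long_root (n + l) (n + k) s u) (\<phi> t) = of_real ((1 + q powi c) * reg_factor q (c - 1))"
proof -
  have S: "long_root (n + l) (n + k) s u \<in> long_roots N" "long_root (n + l) (n + k) s u \<in> roots_B N"
    using long_root_mem[of "n + l" "n + k" N s u] assms by (auto simp: roots_B_def)
  have m: "v powr (-2 * hm_plus H2 (long_root (n + l) (n + k) s u)) = q powi (- 1)"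
    "v powr (-2 * hm_minus H2 (long_root (n + l) (n + k) s u)) = 1"
    using S(1) by (simp_all only: params_H2 if_True)
  have c1: "c - 1 = - 1 - (s * expo l + u * expo k)" by (simp add: c)
  from tail_factors[OF S(2) tail_long_value[OF lk q_pos su] m(1)]
  show "num_factor (long_root (n + l) (n + k) s u) (\<phi> t) = of_real ((1 + q powi c) * reg_factor q c)"
    "den_factor (long_root (n + l) (n + k) s u) (\<phi> t) = of_real ((1 + q powi c) * reg_factor q (c - 1))"
    unfolding m(2) c1 unfolding c mult_1 by blast+
qed

lemma tail_quotient:
  "num_tail t * of_real tail_minus =
   den_tail t * of_real (tail_plus q p * tail_short (reg_factor q) p * tail_long (reg_factor q) p)"
proof -
  let ?w = "reg_factor q"
  have w: "?w k \<noteq> 0" for k by (rule reg_factor_nonzero[OF q_gt_1])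
  define A where "A = (\<Prod>k<2 * p. ?w (expo k) * ?w (- expo k))"
  define B where "B = (\<Prod>k<2 * p. ?w (1 - int p + expo k) * ?w (1 - int p - expo k))"
  define X where "X = (\<Prod>k<2 * p. \<Prod>l<k. (1 + q powi (expo k + expo l)) * (1 + q powi (expo k - expo l)) *
     (1 + q powi (- expo k + expo l)) * (1 + q powi (- expo k - expo l)))"
  define C where "C = (\<Prod>k<2 * p. \<Prod>l<k. ?w (expo k + expo l) * ?w (expo k - expo l) *
     ?w (- expo k + expo l) * ?w (- expo k - expo l))"
  define D where "D = (\<Prod>k<2 * p. \<Prod>l<k. ?w (expo k + expo l - 1) * ?w (expo k - expo l - 1) *
     ?w (- expo k + expo l - 1) * ?w (- expo k - expo l - 1))"
  have nz: "B \<noteq> 0" "D \<noteq> 0" unfolding B_def D_def using w by simp_all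
  have ns: "(\<Prod>k<2 * p. num_factor (short_root (n + k) 1) (\<phi> t) * num_factor (short_root (n + k) (-1)) (\<phi> t)) =
    of_real (tail_plus q p * A)"
    unfolding tail_plus_def A_def prod.distrib[symmetric] of_real_prod
    by (rule prod.cong[OF refl]) (simp add: tail_short_factors del: of_real_power_int)
  have ds: "(\<Prod>k<2 * p. den_factor (short_root (n + k) 1) (\<phi> t) * den_factor (short_root (n + k) (-1)) (\<phi> t)) =
    of_real (tail_minus * B)"
    unfolding tail_minus_def B_def prod.distrib[symmetric] of_real_prod
    by (rule prod.cong[OF refl]) (simp add: tail_short_factors del: of_real_power_int)
  have nl: "(\<Prod>k<2 * p. \<Prod>l<k. num_factor (long_root (n + l) (n + k) 1 1) (\<phi> t) * num_factor (long_root (n + l) (n + k) 1 (-1)) (\<phi> t) *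
     num_factor (long_root (n + l) (n + k) (-1) 1) (\<phi> t) * num_factor (long_root (n + l) (n + k) (-1) (-1)) (\<phi> t)) = of_real (X * C)"
    unfolding X_def C_def prod.distrib[symmetric] of_real_prod
  proof (intro prod.cong refl)
    fix k l assume "k \<in> {..<2 * p}" "l \<in> {..<k}"
    then have lk: "l < k" "k < 2 * p" by simp_all
    have "num_factor (long_root (n + l) (n + k) 1 1) (\<phi> t) = of_real ((1 + q powi (- expo k - expo l)) * ?w (- expo k - expo l))"
      "num_factor (long_root (n + l) (n + k) 1 (-1)) (\<phi> t) = of_real ((1 + q powi (expo k - expo l)) * ?w (expo k - expo l))"
      "num_factor (long_root (n + l) (n + k) (-1) 1) (\<phi> t) = of_real ((1 + q powi (- expo k + expo l)) * ?w (- expo k + expo l))"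
      "num_factor (long_root (n + l) (n + k) (-1) (-1)) (\<phi> t) = of_real ((1 + q powi (expo k + expo l)) * ?w (expo k + expo l))"
      by (rule tail_long_factors(1)[OF lk]; simp)+
    then show "num_factor (long_root (n + l) (n + k) 1 1) (\<phi> t) * num_factor (long_root (n + l) (n + k) 1 (-1)) (\<phi> t) *
     num_factor (long_root (n + l) (n + k) (-1) 1) (\<phi> t) * num_factor (long_root (n + l) (n + k) (-1) (-1)) (\<phi> t) =
      of_real ((1 + q powi (expo k + expo l)) * (1 + q powi (expo k - expo l)) *
     (1 + q powi (- expo k + expo l)) * (1 + q powi (- expo k - expo l)) * (?w (expo k + expo l) * ?w (expo k - expo l) *
     ?w (- expo k + expo l) * ?w (- expo k - expo l)))"
      by (simp only: of_real_mult mult_ac)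
  qed
  have dl: "(\<Prod>k<2 * p. \<Prod>l<k. den_factor (long_root (n + l) (n + k) 1 1) (\<phi> t) * den_factor (long_root (n + l) (n + k) 1 (-1)) (\<phi> t) *
     den_factor (long_root (n + l) (n + k) (-1) 1) (\<phi> t) * den_factor (long_root (n + l) (n + k) (-1) (-1)) (\<phi> t)) = of_real (X * D)"
    unfolding X_def D_def prod.distrib[symmetric] of_real_prod
  proof (intro prod.cong refl)
    fix k l assume "k \<in> {..<2 * p}" "l \<in> {..<k}"
    then have lk: "l < k" "k < 2 * p" by simp_all
    have "den_factor (long_root (n + l) (n + k) 1 1) (\<phi> t) = of_real ((1 + q powi (- expo k - expo l)) * ?w (- expo k - expo l - 1))"
      "den_factor (long_root (n + l) (n + k) 1 (-1)) (\<phi> t) = of_real ((1 + q powi (expo k - expo l)) * ?w (expo k - expo l - 1))"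
      "den_factor (long_root (n + l) (n + k) (-1) 1) (\<phi> t) = of_real ((1 + q powi (- expo k + expo l)) * ?w (- expo k + expo l - 1))"
      "den_factor (long_root (n + l) (n + k) (-1) (-1)) (\<phi> t) = of_real ((1 + q powi (expo k + expo l)) * ?w (expo k + expo l - 1))"
      by (rule tail_long_factors(2)[OF lk]; simp)+
    then show "den_factor (long_root (n + l) (n + k) 1 1) (\<phi> t) * den_factor (long_root (n + l) (n + k) 1 (-1)) (\<phi> t) *
     den_factor (long_root (n + l) (n + k) (-1) 1) (\<phi> t) * den_factor (long_root (n + l) (n + k) (-1) (-1)) (\<phi> t) =
      of_real ((1 + q powi (expo k + expo l)) * (1 + q powi (expo k - expo l)) *
     (1 + q powi (- expo k + expo l)) * (1 + q powi (- expo k - expo l)) * (?w (expo k + expo l - 1) * ?w (expo k - expo l - 1) *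
     ?w (- expo k + expo l - 1) * ?w (- expo k - expo l - 1)))"
      by (simp only: of_real_mult mult_ac)
  qed
  have "tail_short ?w p = A / B" "tail_long ?w p = C / D"
    unfolding tail_short_def tail_long_def pair_quot_def prod_dividef A_def B_def C_def D_def by (rule refl)+
  then have "tail_plus q p * A * (X * C) * tail_minus =
      tail_minus * B * (X * D) * (tail_plus q p * tail_short ?w p * tail_long ?w p)"
    using nz by simp
  then show ?thesis unfolding ns ds nl dl by (metis of_real_mult)
qed

abbreviation "F x \<equiv> norm_prod b \<bar>x\<bar> v"

section \<open>Comparison of the constants\<close>

text \<open>The factors \<open>1/2\<close> from the second differences of the normalisation product at \<open>0\<close>. They depend on
  \<open>m\<^sub>-\<close> and \<open>p\<close>, but not on \<open>v\<close>.\<close>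

definition half_prod :: real where
  "half_prod = (\<Prod>k<2 * p. (if mm + expo k = 0 then 1 / 2 else 1) * (if mm - expo k = 0 then 1 / 2 else 1))"

text \<open>By \<open>norm_factor b v x * (1 + q\<^bsup>-x\<^esup>) = v\<^bsup>-bx\<^esup>\<close>, the product \<open>tail_minus\<close> is inverse to a product of second
  differences of the normalisation product, up to a power of \<open>q\<close> and \<open>half_prod\<close>.\<close>
lemma norm_prod_ratio:
  "F (mm + p + 1) * F (mm - p - 1) * tail_minus = F (mm + p - 1) * F (mm - p + 1) * q powr (- 2 * p * mm) * half_prod"
proof -
  let ?g = "\<lambda>x. norm_factor b v x * (if x = 0 then 1 / 2 else 1)"
  have v0: "v > 0" using v by simp
  have Fnz: "F x \<noteq> 0" for x using norm_prod_pos[OF v0, of b "\<bar>x\<bar>"] by simp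
  have "(\<Prod>k<2 * p. ?g (mm + expo k) * ?g (mm - expo k)) =
    F (mm + p + 1) * F (mm - p - 1) / (F (mm + p - 1) * F (mm - p + 1))"
  proof (rule prod_second_difference)
    fix j :: int
    have "2 * (mm + j) \<in> \<int>" using half by (simp add: distrib_left)
    then show "F (mm + j + 1) * F (mm + j - 1) = (F (mm + j))\<^sup>2 * ?g (mm + j)"
      by (rule norm_prod_second_difference[OF v0])
  qed (rule Fnz)
  also have "(\<Prod>k<2 * p. ?g (mm + expo k) * ?g (mm - expo k)) =
     (\<Prod>k<2 * p. norm_factor b v (mm + expo k) * norm_factor b v (mm - expo k)) * half_prod"
    unfolding half_prod_def prod.distrib[symmetric] by (rule prod.cong) simp_all
  finally have quot: "(\<Prod>k<2 * p. norm_factor b v (mm + expo k) * norm_factor b v (mm - expo k)) * half_prod =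
     F (mm + p + 1) * F (mm - p - 1) / (F (mm + p - 1) * F (mm - p + 1))" .
  have "z = x / y \<Longrightarrow> y \<noteq> 0 \<Longrightarrow> x = y * z" for x y z :: real by simp
  note solve = this
  have ratio: "F (mm + p + 1) * F (mm - p - 1) = F (mm + p - 1) * F (mm - p + 1) *
     ((\<Prod>k<2 * p. norm_factor b v (mm + expo k) * norm_factor b v (mm - expo k)) * half_prod)"
    by (rule solve[OF quot]) (intro no_zero_divisors Fnz)
  have g: "norm_factor b v x * (1 + q powr (- x)) = v powr (- real b * x)" for x
  proof -
    have "v\<^sup>2 = v powr 2" using v by simp
    then have "(v\<^sup>2) powr (real b * x) = q powr x" by (simp only: q_powr powr_powr mult.assoc)
    moreover have "v powr (real b * x) = v powr (- real b * x) * q powr x"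
      by (simp add: q_powr powr_add[symmetric] mult.commute)
    moreover have "q powr (- x) = 1 / q powr x" by (simp add: powr_minus_divide)
    moreover have "1 + q powr x \<noteq> 0" "q powr x \<noteq> 0" using powr_gt_zero[of q x] q_pos by linarith+
    ultimately show ?thesis unfolding norm_factor_def by (simp add: field_simps)
  qed
  have "(\<Prod>k<2 * p. norm_factor b v (mm + expo k) * norm_factor b v (mm - expo k)) * tail_minus =
     (\<Prod>k<2 * p. q powr (- mm))"
    unfolding tail_minus_def prod.distrib[symmetric]
  proof (rule prod.cong[OF refl])
    fix k
    have e: "q powr (- mm) * q powi (- expo k) = q powr (- (mm + expo k))"
      "q powr (- mm) * q powi (expo k) = q powr (- (mm - expo k))"
    proof -
      have "q powi j = q powr of_int j" for j using q_pos by (simp add: powr_real_of_int')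
      then show "q powr (- mm) * q powi (- expo k) = q powr (- (mm + expo k))"
        "q powr (- mm) * q powi (expo k) = q powr (- (mm - expo k))"
        by (simp_all only: powr_add[symmetric]) simp_all
    qed
    have "norm_factor b v (mm + expo k) * norm_factor b v (mm - expo k) *
      ((1 + q powr (- mm) * q powi (- expo k)) * (1 + q powr (- mm) * q powi expo k)) =
      (norm_factor b v (mm + expo k) * (1 + q powr (- (mm + expo k)))) * (norm_factor b v (mm - expo k) * (1 + q powr (- (mm - expo k))))"
      unfolding e by (simp only: mult_ac)
    also have "\<dots> = q powr (- mm)"
      unfolding g unfolding q_powr powr_add[symmetric] by (simp add: algebra_simps)
    finally show "norm_factor b v (mm + expo k) * norm_factor b v (mm - expo k) *
      ((1 + q powr (- mm) * q powi (- expo k)) * (1 + q powr (- mm) * q powi expo k)) = q powr (- mm)" .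
  qed
  also have "\<dots> = q powr (- 2 * p * mm)"
    using q_pos by (simp add: powr_power mult_ac)
  finally have "(\<Prod>k<2 * p. norm_factor b v (mm + expo k) * norm_factor b v (mm - expo k)) * tail_minus = q powr (- 2 * p * mm)" .
  then show ?thesis unfolding ratio by (simp add: mult_ac)
qed

end

definition rational_constant :: "nat \<Rightarrow> real \<Rightarrow> rat" where
  "rational_constant p mm = (if p = 0 then 1 else 4) /
     (\<Prod>k<2 * p. (if mm + expo k = 0 then 1 / 2 else 1) * (if mm - expo k = 0 then 1 / 2 else 1))"

lemma rational_constant_nonzero: "rational_constant p mm \<noteq> 0"
  by (simp add: rational_constant_def)

context strip_transfer begin

lemma half_prod_pos: "half_prod > 0"
  unfolding half_prod_def by (intro prod_pos) auto

lemma rational_constant_half_prod: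
  "of_rat (rational_constant p mm) * half_prod = (if p = 0 then 1 else 4 :: real)"
proof -
  have "half_prod = of_rat (\<Prod>k<2 * p. (if mm + expo k = 0 then 1 / 2 else 1) * (if mm - expo k = 0 then 1 / 2 else 1))"
    unfolding half_prod_def of_rat_prod by (rule prod.cong) (simp_all add: of_rat_mult of_rat_divide)
  then have "of_rat (rational_constant p mm) = (if p = 0 then 1 else 4) / half_prod"
    by (simp add: rational_constant_def of_rat_divide)
  then show ?thesis using half_prod_pos by simp
qed

lemma mu_const_source:
  "mu_const H1 v = (v powi int b - v powi (- int b)) powi (- int n) * (F (mm - p - 1) * F (mm + p + 1)) *
     q powr (- (real n * (real n - 1) + real n * (real p + 1 + mm)))"
proof -
  have "(\<Sum>a\<in>P. hm_plus H1 a + hm_minus H1 a) = (\<Sum>a\<in>P. if a \<in> long_roots n then real b else real b * (real p + 1) + real b * mm)"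
    by (rule sum.cong) (simp_all add: hecke_B_def Let_def)
  also have "\<dots> = real n * (real n - 1) * b + real n * (real b * (real p + 1) + real b * mm)"
    by (rule sum_positive_system[OF P])
  finally have "v powr (-2 * (\<Sum>a\<in>hpos H1. hm_plus H1 a + hm_minus H1 a)) =
     q powr (- (real n * (real n - 1) + real n * (real p + 1 + mm)))"
    unfolding params_H1 q_powr by (simp add: algebra_simps)
  moreover have "hnorm H1 v = (v powi int b - v powi (- int b)) powi (- int n) * (F (mm - p - 1) * F (mm + p + 1))"
    by (simp add: hecke_B_def Let_def d_norm_def mult.assoc diff_diff_eq add.assoc)
  ultimately show ?thesis unfolding mu_const_def by simp
qed

lemma mu_const_target:
  "mu_const H2 v = (v powi int b - v powi (- int b)) powi (- int N) * (F (mm - p + 1) * F (mm + p - 1)) *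
     q powr (- (real N * (real N - 1) + real N * (real p - 1 + mm)))"
proof -
  have "(\<Sum>a\<in>Q. hm_plus H2 a + hm_minus H2 a) = (\<Sum>a\<in>Q. if a \<in> long_roots N then real b else real b * (real p - 1) + real b * mm)"
    by (rule sum.cong) (simp_all add: hecke_B_def Let_def b_par_shift)
  also have "\<dots> = real N * (real N - 1) * b + real N * (real b * (real p - 1) + real b * mm)"
    by (rule sum_positive_system[OF Q])
  finally have S: "(\<Sum>a\<in>Q. hm_plus H2 a + hm_minus H2 a) = real N * (real N - 1) * b + real N * (real b * (real p - 1) + real b * mm)" .
  have "v powr (-2 * (\<Sum>a\<in>hpos H2. hm_plus H2 a + hm_minus H2 a)) =
     q powr (- (real N * (real N - 1) + real N * (real p - 1 + mm)))"
    unfolding params_H2 q_powr S by (simp add: algebra_simps)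
  moreover have "hnorm H2 v = (v powi int b - v powi (- int b)) powi (- int N) * (F (mm - p + 1) * F (mm + p - 1))"
  proof -
    have "mm - (real p - 1) = mm - p + 1" "mm + (real p - 1) = mm + p - 1" by simp_all
    then show ?thesis
      unfolding hecke_B_def Let_def hecke_datum.simps d_norm_def b_par_shift by (simp only: mult.assoc)
  qed
  ultimately show ?thesis unfolding mu_const_def by simp
qed

text \<open>\<open>(v\<^bsup>b\<^esup> - v\<^bsup>-b\<^esup>)\<^sup>2 = (q - 1)\<^sup>2 / q\<close>; this cancels the powers of \<open>q - 1\<close> in \<open>tail_value\<close>.\<close>
lemma norm_base_powi:
  "(v powi int b - v powi (- int b)) powi (- int N) =
   (v powi int b - v powi (- int b)) powi (- int n) * (q ^ p / (q - 1) ^ (2 * p))"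
proof -
  define z where "z = v powi int b - v powi (- int b)"
  define w where "w = v ^ b"
  have w: "w > 1" unfolding w_def using v b_pos by (intro one_less_power) simp_all
  have qw: "q = w\<^sup>2" unfolding q_def w_def by (simp add: power_mult[symmetric] mult.commute)
  have zw: "z = (q - 1) / w"
  proof -
    have "v powi int b = w" "v powi (- int b) = inverse w"
      by (simp_all only: w_def power_int_of_nat power_int_minus)
    then show ?thesis using w unfolding z_def qw by (simp add: field_simps power2_eq_square)
  qed
  have z: "z \<noteq> 0" using zw w q_gt_1 by simp
  have "z ^ (2 * p) = (q - 1) ^ (2 * p) / q ^ p"
    unfolding zw power_divide qw by (simp add: power_mult)
  moreover have "z powi (- int N) = z powi (- int n) * z powi (- int (2 * p))"
    using z by (simp add: power_int_add[symmetric])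
  moreover have "z powi (- int (2 * p)) = inverse (z ^ (2 * p))"
    by (simp only: power_int_minus power_int_of_nat)
  ultimately show ?thesis unfolding z_def[symmetric] by simp
qed

text \<open>The factor \<open>q\<^bsup>(4p - 2)n\<^esup>\<close> is the contribution of the mixed roots. That all exponents of \<open>q\<close>
  add up to those on the right is \<open>expo_eq\<close> in the proof.\<close>
lemma constant_identity:
  "mu_const H2 v * q powi ((4 * int p - 2) * int n) * (tail_plus q p * tail_short (reg_factor q) p * tail_long (reg_factor q) p) =
   of_rat (rational_constant p mm) * mu_const H1 v * tail_minus"
proof -
  define Z where "Z = (v powi int b - v powi (- int b)) powi (- int n)"
  define G where "G = F (mm - p + 1) * F (mm + p - 1)"
  define C :: real where "C = (if p = 0 then 1 else 4)"
  have powi: "q powi k = q powr (of_int k)" for k using q_pos by (simp add: powr_real_of_int')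
  have pow: "q ^ p = q powr p" using q_pos by (simp add: powr_realpow)
  have expo_eq: "real p + (- (real N * (real N - 1) + real N * (real p - 1 + mm))) + real_of_int ((4 * int p - 2) * int n) +
     real_of_int (int p * (6 * int p - 5)) = - (real n * (real n - 1) + real n * (real p + 1 + mm)) + (- 2 * p * mm)"
    by (simp add: algebra_simps)
  have "mu_const H2 v * q powi ((4 * int p - 2) * int n) * (tail_plus q p * tail_short (reg_factor q) p * tail_long (reg_factor q) p) =
    Z * (q ^ p / (q - 1) ^ (2 * p)) * G * q powr (- (real N * (real N - 1) + real N * (real p - 1 + mm))) *
     q powi ((4 * int p - 2) * int n) * (C * q powi (int p * (6 * int p - 5)) * (q - 1) ^ (2 * p))"
    unfolding mu_const_target norm_base_powi tail_value[OF q_gt_1] Z_def G_def C_def by (rule refl)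
  also have "\<dots> = Z * G * C * (q powr p * q powr (- (real N * (real N - 1) + real N * (real p - 1 + mm))) *
     q powr real_of_int ((4 * int p - 2) * int n) * q powr real_of_int (int p * (6 * int p - 5)))"
    unfolding pow powi using q_gt_1 by simp
  also have "\<dots> = Z * G * C * (q powr (- (real n * (real n - 1) + real n * (real p + 1 + mm))) * q powr (- 2 * p * mm))"
    unfolding powr_add[symmetric] expo_eq by (rule refl)
  also have "C = of_rat (rational_constant p mm) * half_prod"
    unfolding C_def by (rule rational_constant_half_prod[symmetric])
  also have "Z * G * (of_rat (rational_constant p mm) * half_prod) *
      (q powr (- (real n * (real n - 1) + real n * (real p + 1 + mm))) * q powr (- 2 * p * mm)) =
    of_rat (rational_constant p mm) * (Z * q powr (- (real n * (real n - 1) + real n * (real p + 1 + mm)))) *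
      (F (mm + p - 1) * F (mm - p + 1) * q powr (- 2 * p * mm) * half_prod)"
    unfolding G_def by (simp only: mult_ac)
  also have "\<dots> = of_rat (rational_constant p mm) * mu_const H1 v * tail_minus"
    unfolding norm_prod_ratio[symmetric] mu_const_source Z_def by (simp only: mult_ac)
  finally show ?thesis .
qed

lemma tail_minus_pos: "tail_minus > 0"
  unfolding tail_minus_def using q_pos by (intro prod_pos ballI mult_pos_pos add_pos_pos) simp_all

lemma cross_identity:
  assumes t: "t \<in> carrier (torus n)"
  shows "fst (mu_reg H2 v L) (\<phi> t) * snd (mu_fun H1 v) t =
    of_real (of_rat (rational_constant p mm)) * fst (mu_fun H1 v) t * snd (mu_reg H2 v L) (\<phi> t)"
proof -
  let ?c = "of_real (of_rat (rational_constant p mm)) :: complex"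
  define K1 K2 :: complex where "K1 = of_real (mu_const H1 v)" and "K2 = of_real (mu_const H2 v)"
  define HN where "HN = (\<Prod>a\<in>roots_B n. 1 - inverse ((char_val n a t)\<^sup>2))"
  define DS where "DS = (\<Prod>a\<in>roots_B n. den_source a t)"
  define DH where "DH = (\<Prod>a\<in>roots_B n. den_factor a (\<phi> t))"
  define MN where "MN = (\<Prod>i<n. num_mixed i t)"
  define MD where "MD = (\<Prod>i<n. den_mixed i t)"
  define TN where "TN = num_tail t"
  define TD where "TD = den_tail t"
  define e :: complex where "e = of_real (q powi ((4 * int p - 2) * int n))"
  define T :: complex where "T = of_real (tail_plus q p * tail_short (reg_factor q) p * tail_long (reg_factor q) p)"
  define M :: complex where "M = of_real tail_minus"
  have M: "M \<noteq> 0" using tail_minus_pos by (simp add: M_def)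
  have head: "DS * MN = e * (DH * MD)"
    unfolding DS_def MN_def e_def DH_def MD_def by (rule head_mixed[OF t])
  have tail: "TN * M = TD * T" unfolding TN_def M_def TD_def T_def by (rule tail_quotient)
  have const: "K2 * e * T = ?c * K1 * M"
    unfolding K1_def K2_def e_def T_def M_def of_real_mult[symmetric] constant_identity by (rule refl)
  have "(\<Prod>a\<in>roots_B n. num_factor a (\<phi> t)) = HN"
    unfolding HN_def by (rule prod.cong[OF refl num_factor_head])
  then have fst_reg: "fst (mu_reg H2 v L) (\<phi> t) = K2 * (HN * MN * TN)"
    unfolding mu_reg_factors prod_roots_B_split K2_def MN_def TN_def by simp
  have snd_reg: "snd (mu_reg H2 v L) (\<phi> t) = DH * MD * TD"
    unfolding mu_reg_factors prod_roots_B_split DH_def MD_def TD_def by (rule refl)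
  have "M * (K2 * e * TN) = K2 * e * (TN * M)" by (simp only: mult_ac)
  also have "\<dots> = (K2 * e * T) * TD" unfolding tail by (simp only: mult_ac)
  also have "\<dots> = M * (?c * K1 * TD)" unfolding const by (simp only: mult_ac)
  finally have KT: "K2 * e * TN = ?c * K1 * TD" using M by simp
  have "K2 * (HN * MN * TN) * DS = K2 * HN * TN * (DS * MN)" by (simp only: mult_ac)
  also have "\<dots> = (K2 * e * TN) * (HN * DH * MD)" unfolding head by (simp only: mult_ac)
  also have "\<dots> = ?c * (K1 * HN) * (DH * MD * TD)" unfolding KT by (simp only: mult_ac)
  finally show ?thesis
    unfolding fst_reg snd_reg mu_fun_factors DS_def[symmetric] HN_def[symmetric] K1_def[symmetric] .
qed

lemma one_plus_real_inverse: assumes "Im z \<noteq> 0" shows "1 + of_real r * inverse z \<noteq> 0" "1 - of_real r * inverse z \<noteq> 0"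
proof -
  have z: "z \<noteq> 0" using assms by auto
  have "Im (z + of_real r) \<noteq> 0" "Im (z - of_real r) \<noteq> 0" using assms by simp_all
  then have "z + of_real r \<noteq> 0" "z - of_real r \<noteq> 0" by (metis zero_complex.sel(2))+
  moreover have "1 + of_real r * inverse z = (z + of_real r) / z" "1 - of_real r * inverse z = (z - of_real r) / z"
    using z by (simp_all add: field_simps)
  ultimately show "1 + of_real r * inverse z \<noteq> 0" "1 - of_real r * inverse z \<noteq> 0" using z by simp_all
qed

lemma den_source_generic: "snd (mu_fun H1 v) (generic_point n) \<noteq> 0"
proof -
  have "den_source a (generic_point n) \<noteq> 0" if a: "a \<in> roots_B n" for a
  proof -
    have "\<not> (\<forall>i<n. a i = 0)"
      using a by (cases rule: roots_B_cases) (auto simp: short_root_def long_root_def)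
    then have "Im (char_val n a (generic_point n)) \<noteq> 0"
      using head_root_value[OF head_root(4)[OF a] _ q_pos] head_root(1)[OF a] by simp
    then show ?thesis unfolding den_source_def using one_plus_real_inverse by simp
  qed
  then show ?thesis unfolding mu_fun_factors using finite_roots_B by (simp add: prod_zero_iff)
qed

lemma den_factor_generic: "snd (mu_reg H2 v L) (\<phi> (generic_point n)) \<noteq> 0"
proof -
  have "den_factor a (\<phi> (generic_point n)) \<noteq> 0" if a: "a \<in> roots_B N" for a
  proof (cases "\<forall>i<n. a i = 0")
    case False
    then show ?thesis
      using head_root_value[OF a _ q_pos] one_plus_real_inverse unfolding den_factor_def by simp
  next
    case True
    obtain c where c: "\<And>t. char_val N a (\<phi> t) = of_real (q powi c)"
      by (rule tail_root_value[OF a True q_pos]) blast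
    obtain m where m: "v powr (-2 * hm_plus H2 a) = q powi m" unfolding params_H2 by metis
    have "1 + v powr (-2 * hm_minus H2 a) * q powi (- c) > 0"
      using v q_pos by (intro add_pos_pos mult_pos_pos) simp_all
    then have "(1 + v powr (-2 * hm_minus H2 a) * q powi (- c)) * reg_factor q (m - c) \<noteq> 0"
      using reg_factor_nonzero[OF q_gt_1, of "m - c"] by (intro no_zero_divisors) simp_all
    then show ?thesis unfolding tail_factors[OF a c m] by (simp only: of_real_eq_0_iff not_False_eq_True)
  qed
  then show ?thesis unfolding mu_reg_factors using finite_roots_B by (simp add: prod_zero_iff)
qed

lemma psi_eq: "psi_T n mm (Suc p) v = \<phi>"
proof (intro ext)
  fix t i
  have "(v\<^sup>2) ^ (b * ((i - n + 1) div 2)) = q powi expo (i - n)"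
    unfolding q_def expo_def power_int_of_nat by (simp add: power_mult)
  moreover have "b_par mm (real (Suc p)) = b" by (simp add: add.commute)
  ultimately show "psi_T n mm (Suc p) v t i = \<phi> t i"
    unfolding psi_T_def strip_embed_def by simp
qed

end

section \<open>The spectral transfer morphism\<close>

lemma complex_of_rat: "(of_rat r :: complex) = of_real (of_rat r)"
proof (cases r)
  case (Fract a c)
  then show ?thesis by (simp add: of_rat_rat)
qed

theorem mainTheorem2:
  fixes n mp :: nat and mm :: real and P Q :: "(nat \<Rightarrow> int) set"
  assumes "mp > 0"
    and "4 * mm \<in> \<int>" and "2 * (mm + real mp) \<in> \<int>" and "2 * (mm - real mp) \<in> \<int>"
    and "positive_system n P" and "positive_system (n + 2 * mp - 2) Q"
  shows "spectral_transfer_morphism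
           (hecke_B n P mm (real mp))
           (hecke_B (n + 2 * mp - 2) Q mm (real mp - 2))
           (psi_T n mm mp)"
proof -
  define p where "p = mp - 1"
  have mp: "mp = Suc p" using assms(1) by (simp add: p_def)
  have idx: "n + 2 * mp - 2 = n + 2 * p" "real mp = real p + 1" "real mp - 2 = real p - 1" by (simp_all add: mp)
  have "2 * mm = 2 * (mm + real mp) - of_nat (2 * mp)" by simp
  then have half: "2 * mm \<in> \<int>" using assms(3) by (metis Ints_diff Ints_of_nat)
  have tr: "strip_transfer n p mm v P Q" if "v > 1" for v
    using that half assms(5,6) unfolding strip_transfer_def idx by simp
  let ?H1 = "hecke_B n P mm (real p + 1)" and ?H2 = "hecke_B (n + 2 * p) Q mm (real p - 1)"
  let ?\<psi> = "psi_T n mm mp" and ?c = "rational_constant p mm"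
  have rank: "hrank ?H1 = n" "hrank ?H2 = n + 2 * p" by (simp_all add: hecke_B_def Let_def)
  have geo: "residual_coset ?H2 v (?\<psi> v ` carrier (torus n)) \<and>
     finite_morphism n (n + 2 * p) (?\<psi> v) \<and>
     ?\<psi> v \<one>\<^bsub>torus n\<^esub> \<in> ?\<psi> v ` carrier (torus n) \<inter> T_sub (n + 2 * p) (?\<psi> v ` carrier (torus n)) \<and>
     ?\<psi> v \<in> hom (torus n) (based_coset (torus (n + 2 * p)) (?\<psi> v ` carrier (torus n)) (?\<psi> v \<one>\<^bsub>torus n\<^esub>))"
    if v: "v > 1" for v
  proof -
    interpret strip_transfer n p mm v P Q by (rule tr[OF v])
    have psi: "?\<psi> v = strip_embed n p q" unfolding mp by (rule psi_eq)
    have "\<one>\<^bsub>torus n\<^esub> \<in> carrier (torus n)" by (simp add: torus_simps)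
    moreover have "strip_embed n p q \<one>\<^bsub>torus n\<^esub> \<in> coord_subtorus n (2 * p)"
      using q_pos by (simp add: strip_embed_def coord_subtorus_def)
    ultimately show ?thesis
      unfolding psi T_sub_coord[OF constant_roots_strip[OF q_pos]]
      using residual strip_embed_finite[OF q_pos, of n p] strip_embed_hom[OF q_pos, of n p] by blast
  qed
  have mu: "ratfun_eq (carrier (torus n)) (ratfun_pullback (?\<psi> v) (mu_reg ?H2 v (?\<psi> v ` carrier (torus n))))
       (ratfun_scale (of_rat ?c) (mu_fun ?H1 v))" if v: "v > 1" for v
  proof -
    interpret strip_transfer n p mm v P Q by (rule tr[OF v])
    have psi: "?\<psi> v = strip_embed n p q" unfolding mp by (rule psi_eq)
    show ?thesis
      unfolding ratfun_eq_def ratfun_pullback_def ratfun_scale_def fst_conv snd_conv o_def psi complex_of_rat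
      using generic_point_mem den_factor_generic den_source_generic cross_identity by blast
  qed
  show ?thesis
    unfolding spectral_transfer_morphism_def Let_def idx(1,3) unfolding idx(2) rank
  proof (intro conjI exI[of _ ?c] allI impI)
    fix v :: real assume v: "v > 1"
    note g = geo[OF v]
    show "residual_coset ?H2 v (?\<psi> v ` carrier (torus n))" "finite_morphism n (n + 2 * p) (?\<psi> v)"
      "?\<psi> v \<one>\<^bsub>torus n\<^esub> \<in> ?\<psi> v ` carrier (torus n) \<inter> T_sub (n + 2 * p) (?\<psi> v ` carrier (torus n))"
      "?\<psi> v \<in> hom (torus n) (based_coset (torus (n + 2 * p)) (?\<psi> v ` carrier (torus n)) (?\<psi> v \<one>\<^bsub>torus n\<^esub>))"
      using g by blast+
    show "ratfun_eq (carrier (torus n)) (ratfun_pullback (?\<psi> v) (mu_reg ?H2 v (?\<psi> v ` carrier (torus n))))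
       (ratfun_scale (of_rat ?c) (mu_fun ?H1 v))" by (rule mu[OF v])
  qed (rule rational_constant_nonzero)
qed

end
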